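(* Let $\mu_1,\mu_2>0$, $\epsilon_1,\epsilon_2\in\{1,-1\}$, $c\in\mathbb{R}$, let $\lambda_1,\lambda_2$ be real with $|\lambda_2|>|\lambda_1|>|c|$, and let $z_1,z_2$ be variables ($z_2\ne0$). For $j\ge0$ put $\mu_{12}=\mu_1+\mu_2+\tfrac12+j$ and $\epsilon_{12}=\epsilon_1\epsilon_2(-1)^j$. Then the Big $-1$ Jacobi polynomials $J_j$ satisfy $$\Big({}_0F_1\big(-;\mu_1+\tfrac12;\tfrac{z_1^2(\lambda_1^2-c^2)}4\big)+\tfrac{z_1(\lambda_1-c\epsilon_1)}{2\mu_1+1}\,{}_0F_1\big(-;\mu_1+\tfrac32;\tfrac{z_1^2(\lambda_1^2-c^2)}4\big)\Big)$$ $$\times\Big({}_0F_1\big(-;\mu_2+\tfrac12;\tfrac{z_2^2(\lambda_2^2-\lambda_1^2)}4\big)+\tfrac{z_2(\lambda_2-\lambda_1\epsilon_2)}{2\mu_2+1}\,{}_0F_1\big(-;\mu_2+\tfrac32;\tfrac{z_2^2(\lambda_2^2-\lambda_1^2)}4\big)\Big)$$ $$=\sum_{j=0}^\infty K_j^{\epsilon_1\epsilon_2}(\lambda_2;\mu_2,\mu_1;c)\,J_j\Big(\tfrac{\epsilon_2\lambda_1}{\lambda_2};2\mu_2,2\mu_1,-\tfrac{c\epsilon_1\epsilon_2}{\lambda_2}\Big)$$ $$\times\Big(f_e(j)\,{}_0F_1\big(-;\mu_{12}+\tfrac12;\tfrac{(z_1^2+z_2^2)(\lambda_2^2-c^2)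}4\big)+f_o(j)\,\tfrac{(z_1^2+z_2^2)^{1/2}(\lambda_2-c\epsilon_{12})}{2\mu_{12}+1}\,{}_0F_1\big(-;\mu_{12}+\tfrac32;\tfrac{(z_1^2+z_2^2)(\lambda_2^2-c^2)}4\big)\Big).$$
   Context: Notation: $(a)_n=a(a+1)\cdots(a+n-1)$; $[n]_\mu=n+(1-(-1)^n)\mu$; $[n]_\mu!=[1]_\mu\cdots[n]_\mu$, $[0]_\mu!=1$, and $[n]_\mu^{1/2}!=([n]_\mu!)^{1/2}$. Big $-1$ Jacobi polynomials $J_n(x;a,b,c)$: with $y=\frac{1-x^2}{1-c^2}$, for $n$ even $$J_n={}_2F_1\big(-\tfrac n2,\tfrac{n+a+b+2}2;\tfrac{a+1}2;y\big)+\tfrac{n(1-x)}{(1+c)(a+1)}\,{}_2F_1\big(1-\tfrac n2,\tfrac{n+a+b+2}2;\tfrac{a+3}2;y\big),$$ and for $n$ odd $$J_n={}_2F_1\big(-\tfrac{n-1}2,\tfrac{n+a+b+1}2;\tfrac{a+1}2;y\big)-\tfrac{(n+a+b+1)(1-x)}{(1+c)(a+1)}\,{}_2F_1\big(-\tfrac{n-1}2,\tfrac{n+a+b+3}2;\tfrac{a+3}2;y\big)$$ (for $n=0$ the second term is zero, $J_0=1$). Put $$h_n(a,b)=\frac{2\,\Gamma(\frac{n+b+1}2)\Gamma(\frac{n+a+3}2)(\frac n2)!}{(n+a+1)\Gamma(\frac{n+a+b+2}2)\big((\frac{a+1}2)_{n/2}\big)^2}\ (n\text{ even}),\qquad h_n(a,b)=\frac{(n+a+b+1)\Gamma(\frac{n+b+2}2)\Gamma(\frac{n+a+2}2)(\frac{n-1}2)!}{2\,\Gamma(\frac{n+a+b+3}2)\big((\frac{a+1}2)_{(n+1)/2}\big)^2}\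 (n\text{ odd}).$$ For $\alpha,\beta>0$, $\sigma\in\{1,-1\}$, $|\lambda|>|c|$ put $$K_j^{\sigma}(\lambda;\beta,\alpha;c)=\sqrt{\Big(\frac{\lambda^2-c^2}2\Big)^j\Big(\frac{\lambda-c\sigma}{\lambda-(-1)^jc\sigma}\Big)\frac{\Gamma(\alpha+\frac12)\Gamma(\beta+\frac12)}{\Gamma(\alpha+\beta+j+1)\,h_j(2\beta,2\alpha)}}.$$ Writing $j=2j_e+j_p$ with $j_p\in\{0,1\}$, $j_e\ge0$ an integer, $$f_e(j)=(-1)^{j_e+j_p}\frac{z_2^j}{[j]_{\mu_2}^{1/2}!}\Big[\frac{(\frac12+\mu_1)_{j_e+j_p}}{(j_e+j_p+1+\mu_1+\mu_2)_{j_e+j_p}}\Big]^{1/2}$$ $$\times\Big({}_2F_1\big(-j_e,\tfrac12-j_e-j_p-\mu_2;\tfrac12+\mu_1;-(\tfrac{z_1}{z_2})^2\big)+\tfrac{(-1)^{j_p}z_1(j+2\mu_2j_p)}{z_2\epsilon_2(1+2\mu_1)}\,{}_2F_1\big(1-j_e-j_p,\tfrac12-j_e-\mu_2;\tfrac32+\mu_1;-(\tfrac{z_1}{z_2})^2\big)\Big)$$ (for $j=0$ the second term is zero), and $$f_o(j)=(-1)^{j_e+j_p}\Big(\frac{z_1^2}{z_2^2}+1\Big)^{-1/2}\frac{z_2^j}{[j]_{\mu_2}^{1/2}!}\Big[\frac{(\frac12+\mu_1)_{j_e+j_p}}{(j_e+j_p+1+\mu_1+\mu_2)_{j_e+j_p}}\Big]^{1/2}$$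 $$\times\Big({}_2F_1\big(-j_e-j_p,-\tfrac12-j_e-\mu_2;\tfrac12+\mu_1;-(\tfrac{z_1}{z_2})^2\big)+\tfrac{(-1)^{j_p}z_1(j+1+2\mu_1+2\mu_2j_p)}{z_2\epsilon_2(1+2\mu_1)}\,{}_2F_1\big(-j_e,\tfrac12-j_e-j_p-\mu_2;\tfrac32+\mu_1;-(\tfrac{z_1}{z_2})^2\big)\Big).$$
   Formalization: The identity as printed is false: in f_e, f_o the denominator Pochhammer base is corrected to j_e+1+μ1+μ2, and the root K_j carries the sign (sgn λ2)^j. The roots are tied by (z1²+z2²)^{1/2} = z2(z1²/z2²+1)^{1/2}, taken nonzero. *)

theory Defs
  imports "HOL-Analysis.Analysis"
begin

definition hyp0F1 :: "real \<Rightarrow> 'a \<Rightarrow> 'a::{real_normed_field, banach}" where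
  "hyp0F1 b z = eval_fps (fps_hypergeo [] [of_real b] 1) z"

definition hyp2F1 :: "real \<Rightarrow> real \<Rightarrow> real \<Rightarrow> 'a \<Rightarrow> 'a::{real_normed_field, banach}" where
  "hyp2F1 a b c z = eval_fps (fps_hypergeo [of_real a, of_real b] [of_real c] 1) z"

definition mu_number :: "real \<Rightarrow> nat \<Rightarrow> real" where
  "mu_number \<mu> n = real n + (1 - (-1) ^ n) * \<mu>"

definition mu_fact :: "real \<Rightarrow> nat \<Rightarrow> real" where
  "mu_fact \<mu> n = (\<Prod>k=1..n. mu_number \<mu> k)"

text \<open>
  The Big \<open>-1\<close> Jacobi polynomials \<open>J\<^sub>n(x; a, b, c)\<close>. Every \<open>\<^sub>2F\<^sub>1\<close> terminates, except the second
  one for \<open>n = 0\<close>, which is multiplied by \<open>n\<close>.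
\<close>

definition big_m1_jacobi :: "nat \<Rightarrow> real \<Rightarrow> real \<Rightarrow> real \<Rightarrow> real \<Rightarrow> real" where
  "big_m1_jacobi n x a b c =
    (let y = (1 - x\<^sup>2) / (1 - c\<^sup>2); m = real n in
     if even n then
       hyp2F1 (- m / 2) ((m + a + b + 2) / 2) ((a + 1) / 2) y
       + m * (1 - x) / ((1 + c) * (a + 1))
         * hyp2F1 (1 - m / 2) ((m + a + b + 2) / 2) ((a + 3) / 2) y
     else
       hyp2F1 (- (m - 1) / 2) ((m + a + b + 1) / 2) ((a + 1) / 2) y
       - (m + a + b + 1) * (1 - x) / ((1 + c) * (a + 1))
         * hyp2F1 (- (m - 1) / 2) ((m + a + b + 3) / 2) ((a + 3) / 2) y)"

definition jacobi_norm :: "nat \<Rightarrow> real \<Rightarrow> real \<Rightarrow> real" where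
  "jacobi_norm n a b =
    (let m = real n in
     if even n then
       2 * Gamma ((m + b + 1) / 2) * Gamma ((m + a + 3) / 2) * fact (n div 2)
       / ((m + a + 1) * Gamma ((m + a + b + 2) / 2) * (pochhammer ((a + 1) / 2) (n div 2))\<^sup>2)
     else
       (m + a + b + 1) * Gamma ((m + b + 2) / 2) * Gamma ((m + a + 2) / 2) * fact ((n - 1) div 2)
       / (2 * Gamma ((m + a + b + 3) / 2) * (pochhammer ((a + 1) / 2) ((n + 1) div 2))\<^sup>2))"

text \<open>
  The coefficient \<open>K\<^sub>j(\<lambda>; \<beta>, \<alpha>; c)\<close> with sign parameter \<open>\<sigma>\<close>. Its square is a positive real number;
  of the two square roots we take the one with the sign of \<open>\<lambda> ^ j\<close>. For \<open>\<lambda> > 0\<close> this is the usual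
  nonnegative root. The sign cannot be dropped for \<open>\<lambda> < 0\<close>: replacing \<open>\<lambda>\<^sub>1, \<lambda>\<^sub>2, c, z\<^sub>1, z\<^sub>2\<close> by their
  negatives fixes both factors on the product side of the expansion, the \<open>J\<^sub>j\<close> and the nonnegative
  root, but multiplies the remaining factor of the \<open>j\<close>-th term by \<open>(-1) ^ j\<close>.
\<close>

definition K_coeff :: "nat \<Rightarrow> real \<Rightarrow> real \<Rightarrow> real \<Rightarrow> real \<Rightarrow> real \<Rightarrow> real" where
  "K_coeff j \<sigma> lam \<beta> \<alpha> c =
    sgn lam ^ j *
    sqrt (((lam\<^sup>2 - c\<^sup>2) / 2) ^ j * ((lam - c * \<sigma>) / (lam - (-1) ^ j * c * \<sigma>))
      * (Gamma (\<alpha> + 1/2) * Gamma (\<beta> + 1/2))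
      / (Gamma (\<alpha> + \<beta> + real j + 1) * jacobi_norm j (2 * \<beta>) (2 * \<alpha>)))"

text \<open>
  The factor common to \<open>f\<^sub>e\<close> and \<open>f\<^sub>o\<close>; here and below \<open>j = 2 j\<^sub>e + j\<^sub>p\<close> with \<open>j\<^sub>e = j div 2\<close> and
  \<open>j\<^sub>p = j mod 2\<close>. The base of the Pochhammer symbol in the denominator is
  \<open>j\<^sub>e + 1 + \<mu>\<^sub>1 + \<mu>\<^sub>2\<close>. The formula is also found with \<open>j\<^sub>e + j\<^sub>p + 1 + \<mu>\<^sub>1 + \<mu>\<^sub>2\<close>, which agrees for even
  \<open>j\<close> but makes the expansion fail for odd \<open>j\<close>: already for \<open>c = 0\<close>, \<open>z\<^sub>1 = 0\<close> the terms of
  degree one in \<open>z\<^sub>2\<close> differ.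
\<close>

definition f_prefactor :: "real \<Rightarrow> real \<Rightarrow> complex \<Rightarrow> nat \<Rightarrow> complex" where
  "f_prefactor \<mu>1 \<mu>2 z2 j =
    (let je = j div 2; jp = j mod 2 in
     (-1) ^ (je + jp) * (z2 ^ j / complex_of_real (sqrt (mu_fact \<mu>2 j)))
     * complex_of_real (sqrt (pochhammer (1/2 + \<mu>1) (je + jp)
         / pochhammer (real je + 1 + \<mu>1 + \<mu>2) (je + jp))))"

definition f_even :: "real \<Rightarrow> real \<Rightarrow> real \<Rightarrow> complex \<Rightarrow> complex \<Rightarrow> nat \<Rightarrow> complex" where
  "f_even \<mu>1 \<mu>2 \<epsilon>2 z1 z2 j =
    (let je = real (j div 2); jp = real (j mod 2) in
     f_prefactor \<mu>1 \<mu>2 z2 j *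
     (hyp2F1 (- je) (1/2 - je - jp - \<mu>2) (1/2 + \<mu>1) (- (z1 / z2)\<^sup>2)
      + (-1) ^ (j mod 2) * z1 * complex_of_real (real j + 2 * \<mu>2 * jp)
        / (z2 * complex_of_real (\<epsilon>2 * (1 + 2 * \<mu>1)))
        * hyp2F1 (1 - je - jp) (1/2 - je - \<mu>2) (3/2 + \<mu>1) (- (z1 / z2)\<^sup>2)))"

text \<open>
  The argument \<open>s\<close> is the chosen value of \<open>(z\<^sub>1\<^sup>2 / z\<^sub>2\<^sup>2 + 1)\<^bsup>1/2\<^esup>\<close>. The value of
  \<open>(z\<^sub>1\<^sup>2 + z\<^sub>2\<^sup>2)\<^bsup>1/2\<^esup>\<close> that goes with it is \<open>z2 * s\<close>. Independent principal
  branches of the two roots would be incompatible, e.g. for real \<open>z\<^sub>2 < 0\<close>.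
\<close>

definition f_odd :: "real \<Rightarrow> real \<Rightarrow> real \<Rightarrow> complex \<Rightarrow> complex \<Rightarrow> complex \<Rightarrow> nat \<Rightarrow> complex" where
  "f_odd \<mu>1 \<mu>2 \<epsilon>2 z1 z2 s j =
    (let je = real (j div 2); jp = real (j mod 2) in
     inverse s * f_prefactor \<mu>1 \<mu>2 z2 j *
     (hyp2F1 (- je - jp) (- 1/2 - je - \<mu>2) (1/2 + \<mu>1) (- (z1 / z2)\<^sup>2)
      + (-1) ^ (j mod 2) * z1 * complex_of_real (real j + 1 + 2 * \<mu>1 + 2 * \<mu>2 * jp)
        / (z2 * complex_of_real (\<epsilon>2 * (1 + 2 * \<mu>1)))
        * hyp2F1 (- je) (1/2 - je - jp - \<mu>2) (3/2 + \<mu>1) (- (z1 / z2)\<^sup>2)))"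

end

theory Submission
  imports Defs
begin

text \<open>
  Both 0F1 factors split into an even and an odd part in their variable, so the left-hand side is a
  sum of four products of two 0F1, with parameters \<open>(p, q)\<close>, \<open>(p + 1, q)\<close>, \<open>(p, q + 1)\<close>,
  \<open>(p + 1, q + 1)\<close> where \<open>p = \<mu>\<^sub>1 + 1/2\<close>, \<open>q = \<mu>\<^sub>2 + 1/2\<close>. Each of them has Bateman's
  expansion into products of two Jacobi polynomials and one 0F1. On the right-hand side the
  \<open>j\<close>-th term contains the 0F1 with parameters \<open>\<mu>\<^sub>1 + \<mu>\<^sub>2 + 1 + j\<close> and
  \<open>\<mu>\<^sub>1 + \<mu>\<^sub>2 + 2 + j\<close>; shifting the second one and collecting equal parameters combines
  \<open>J\<^sub>j\<close> with \<open>J\<^sub>j\<^sub>-\<^sub>1\<close>, and contiguous relations turn the combinations into the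
  Jacobi polynomials of the four Bateman expansions.

  Bateman's expansion itself is the decomposition of the forms \<open>(U (1 - y)) ^ k (V y) ^ (N - k)\<close>
  into powers of \<open>U + V\<close> times harmonic forms, for the Laplacian
  \<open>U \<partial>\<^sub>U\<^sup>2 + p \<partial>\<^sub>U + V \<partial>\<^sub>V\<^sup>2 + q \<partial>\<^sub>V\<close>. By induction on the degree the two sides
  differ by a harmonic form, and there is only one up to a factor, which is found at \<open>U = - V\<close>.
\<close>

section \<open>Terminating hypergeometric sums\<close>

text \<open>The Laplacian enters because \<open>hyp0F1 b\<close> solves
  \<open>z f'' + b f' = f\<close>. Hence the product of the 0F1 in \<open>U (1 - y)\<close> and in
  \<open>V y\<close> is an eigenfunction with eigenvalue \<open>(1 - y) + y = 1\<close>, whatever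
  \<open>y\<close> is. Splitting its homogeneous parts into harmonic forms gives one Jacobi
  polynomial in \<open>y\<close> and one in \<open>U / V\<close>, and the powers of
  \<open>U + V\<close> add up to a third 0F1.

  The obstacle on the other side is that terms regroup in two ways. A 0F1 whose parameter is \<mu>1
  + \<mu>2 + 1 plus an odd number comes from the terms \<open>2n\<close> and \<open>2n + 1\<close>;
  with a positive even number it comes from \<open>2n + 1\<close> and \<open>2n + 2\<close>. The
  second pairing shifts the index, so partial sums do not match, and each of the four component
  series has to converge by itself. This rests on one observation: apart from a factor
  \<open>1 / n!\<close>, all ingredients of a term grow at most geometrically in
  \<open>n\<close>.\<close>

definition hyp_poly :: "nat \<Rightarrow> real \<Rightarrow> real \<Rightarrow> 'a \<Rightarrow> 'a::real_normed_field" where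
  "hyp_poly n a b z =
    (\<Sum>k\<le>n. of_real ((-1) ^ k * real (n choose k) * pochhammer a k / pochhammer b k) * z ^ k)"

lemma pochhammer_neg_nat_div_fact:
  "pochhammer (- real n) k / fact k = (-1) ^ k * real (n choose k)"
proof -
  have "real (n choose k) = real n gchoose k"
    by (simp add: binomial_gbinomial)
  also have "\<dots> = (-1) ^ k * pochhammer (- real n) k / fact k"
    by (rule gbinomial_pochhammer)
  finally show ?thesis
    by simp
qed

lemma hyp2F1_neg_nat:
  "hyp2F1 (- real n) a b z = (hyp_poly n a b z :: 'a::{real_normed_field, banach})"
proof -
  have nth: "fps_nth (fps_hypergeo [of_real (- real n), of_real a] [of_real b] (1::'a)) k
      = of_real ((-1) ^ k * real (n choose k) * pochhammer a k / pochhammer b k)" for k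
    unfolding pochhammer_neg_nat_div_fact [symmetric]
    by (simp only: fps_hypergeo_nth list.simps foldl_Nil foldl_Cons pochhammer_of_real)
       (simp add: ac_simps)
  show ?thesis
    unfolding hyp2F1_def eval_fps_def nth hyp_poly_def
    by (rule suminf_finite) (auto simp: not_le binomial_eq_0)
qed

text \<open>Absorption, \<open>n * (n - 1 choose k) = (n - k) * (n choose k)\<close>, brings degree
  \<open>n - 1\<close> to the range and binomials of degree \<open>n\<close>, so that contiguous
  relations become identities between coefficients. The factor \<open>n\<close> also makes the
  truncated \<open>n - 1\<close> harmless at \<open>n = 0\<close>.\<close>

lemma hyp_poly_pred:
  "real n * hyp_poly (n - 1) a b y
     = (\<Sum>k\<le>n. (-1) ^ k * (real n - real k) * real (n choose k) * pochhammer a k / pochhammer b k * y ^ k)"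
  for y :: real
proof (cases n)
  case (Suc m)
  have "real n * hyp_poly (n - 1) a b y
      = (\<Sum>k\<le>m. (-1) ^ k * (real n * real (m choose k)) * pochhammer a k / pochhammer b k * y ^ k)"
    by (simp add: hyp_poly_def sum_distrib_left Suc ac_simps)
  also have "\<dots> = (\<Sum>k\<le>m. (-1) ^ k * ((real n - real k) * real (n choose k)) * pochhammer a k / pochhammer b k * y ^ k)"
  proof (rule sum.cong[OF refl])
    fix k assume k: "k \<in> {..m}"
    have "Suc m * (m choose k) = (Suc m - k) * (Suc m choose k)"
      using binomial_absorb_comp[of "Suc m" k] by simp
    then have "real (Suc m * (m choose k)) = real ((Suc m - k) * (Suc m choose k))"
      by (rule arg_cong)
    moreover have "real (Suc m - k) = real (Suc m) - real k"
      using k by (simp add: of_nat_diff)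
    ultimately have "real n * real (m choose k) = (real n - real k) * real (n choose k)"
      by (simp only: of_nat_mult Suc)
    then show "(-1) ^ k * (real n * real (m choose k)) * pochhammer a k / pochhammer b k * y ^ k
        = (-1) ^ k * ((real n - real k) * real (n choose k)) * pochhammer a k / pochhammer b k * y ^ k"
      by (rule arg_cong)
  qed
  finally show ?thesis
    by (simp add: Suc ac_simps)
qed simp

text \<open>Coefficientwise this is \<open>(a + k) + (n - k) = n + a\<close>.\<close>

lemma hyp_poly_contiguous_plus:
  fixes y :: real
  shows "a * hyp_poly n (a + 1) b y + real n * hyp_poly (n - 1) a b y = (real n + a) * hyp_poly n a b y"
proof -
  have rec: "a * pochhammer (a + 1) k = (a + real k) * pochhammer a k" for k
    by (metis pochhammer_rec pochhammer_rec')
  have 1: "a * hyp_poly n (a + 1) b y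
      = (\<Sum>k\<le>n. (-1) ^ k * real (n choose k) * (a * pochhammer (a + 1) k) / pochhammer b k * y ^ k)"
    by (simp add: hyp_poly_def sum_distrib_left ac_simps)
  show ?thesis
    unfolding hyp_poly_pred 1 rec unfolding hyp_poly_def sum_distrib_left
    by (simp only: sum.distrib[symmetric])
       (rule sum.cong[OF refl], simp add: divide_inverse algebra_simps)
qed

text \<open>With \<open>N = Suc n\<close> and after multiplication by \<open>N * a\<close>, the
  coefficients differ by the factor \<open>N (a + k) - a (N - k) = (N + a) k\<close>. The
  \<open>k\<close> kills the constant term and is absorbed by the binomial, which shifts the index
  and produces the factor \<open>y\<close>.\<close>

lemma hyp_poly_contiguous_minus:
  fixes y :: real
  assumes "a > 0" "b > 0"
  shows "hyp_poly (Suc n) (a + 1) b y - hyp_poly n a b y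
       = - (real (Suc n) + a) * y / b * hyp_poly n (a + 1) (b + 1) y"
proof -
  have rec: "a * pochhammer (a + 1) k = (a + real k) * pochhammer a k" for k
    by (metis pochhammer_rec pochhammer_rec')
  define N where "N = Suc n"
  have "real N * (a * (hyp_poly N (a + 1) b y - hyp_poly n a b y))
      = real N * (a * hyp_poly N (a + 1) b y) - a * (real N * hyp_poly (N - 1) a b y)"
    by (simp add: N_def algebra_simps)
  also have "a * hyp_poly N (a + 1) b y
      = (\<Sum>k\<le>N. (-1) ^ k * real (N choose k) * (a * pochhammer (a + 1) k) / pochhammer b k * y ^ k)"
    by (simp add: hyp_poly_def sum_distrib_left ac_simps)
  also have "real N * \<dots> - a * (real N * hyp_poly (N - 1) a b y)
      = (\<Sum>k\<le>N. (real N + a) * ((-1) ^ k * (real k * real (N choose k)) * pochhammer a k / pochhammer b k * y ^ k))"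
    unfolding hyp_poly_pred rec sum_distrib_left
    by (simp only: sum_subtractf[symmetric])
       (rule sum.cong[OF refl], simp add: divide_inverse algebra_simps)
  also have "\<dots> = (\<Sum>k\<le>n. (real N + a) * ((-1) ^ Suc k * (real (Suc k) * real (N choose Suc k))
      * pochhammer a (Suc k) / pochhammer b (Suc k) * y ^ Suc k))"
    unfolding N_def by (subst sum.atMost_Suc_shift) (simp del: binomial_Suc_Suc)
  also have "\<dots> = (\<Sum>k\<le>n. (real N + a) * ((-1) ^ Suc k * (real N * real (n choose k))
      * pochhammer a (Suc k) / pochhammer b (Suc k) * y ^ Suc k))"
  proof -
    have "Suc k * (N choose Suc k) = N * (n choose k)" for k
      unfolding N_def by (rule Suc_times_binomial)
    then have "real (Suc k) * real (N choose Suc k) = real N * real (n choose k)" for k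
      unfolding of_nat_mult[symmetric] by (rule arg_cong)
    then show ?thesis
      by (simp only:)
  qed
  also have "\<dots> = real N * (a * (- (real N + a) * y / b * hyp_poly n (a + 1) (b + 1) y))"
    unfolding hyp_poly_def sum_distrib_left pochhammer_rec
    by (rule sum.cong[OF refl]) (simp add: divide_inverse algebra_simps)
  finally have "hyp_poly N (a + 1) b y - hyp_poly n a b y = - (real N + a) * y / b * hyp_poly n (a + 1) (b + 1) y"
    using assms(1) unfolding mult_cancel_left by (simp add: N_def)
  then show ?thesis
    by (simp only: N_def)
qed

text \<open>Over the denominator \<open>pochhammer (b + 1) k\<close> the coefficients combine by
  \<open>(a - b) (n - k) - (n + b) (a + k) = - (n + a) (b + k)\<close>, and \<open>b + k\<close>
  turns that denominator back into \<open>pochhammer b k\<close>.\<close>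

lemma hyp_poly_contiguous_mixed:
  fixes y :: real
  assumes "b > 0"
  shows "(a - b) * (real n * hyp_poly (n - 1) a (b + 1) y)
       - (real n + b) * (a * hyp_poly n (a + 1) (b + 1) y) = - (real n + a) * b * hyp_poly n a b y"
proof -
  have rec: "a * pochhammer (a + 1) k = (a + real k) * pochhammer a k" for a :: real and k
    by (metis pochhammer_rec pochhammer_rec')
  have pos: "pochhammer (b + 1) k > 0" "pochhammer b k > 0" for k
    using assms by (auto intro: pochhammer_pos)
  have 1: "a * hyp_poly n (a + 1) (b + 1) y
      = (\<Sum>k\<le>n. (-1) ^ k * real (n choose k) * (a * pochhammer (a + 1) k) / pochhammer (b + 1) k * y ^ k)"
    by (simp add: hyp_poly_def sum_distrib_left ac_simps)
  have 2: "b * (1 / pochhammer b k) = (b + real k) * (1 / pochhammer (b + 1) k)" for k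
    using rec[of b k] pos[of k] by (simp add: field_simps)
  have "- (real n + a) * b * hyp_poly n a b y
      = (\<Sum>k\<le>n. - (real n + a) * ((-1) ^ k * real (n choose k) * pochhammer a k) * (b * (1 / pochhammer b k)) * y ^ k)"
    by (simp add: hyp_poly_def sum_distrib_left ac_simps)
  also have "\<dots> = (a - b) * (real n * hyp_poly (n - 1) a (b + 1) y)
       - (real n + b) * (a * hyp_poly n (a + 1) (b + 1) y)"
    unfolding hyp_poly_pred 1 2 rec sum_distrib_left
    by (simp only: sum_subtractf[symmetric])
       (rule sum.cong[OF refl], simp add: divide_inverse algebra_simps)
  finally show ?thesis
    by (rule sym)
qed

section \<open>Bateman's expansion\<close>

text \<open>Extracting \<open>pochhammer q l * pochhammer p N\<close> from the denominators leaves a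
  convolution of two generalized binomial coefficients. Every \<open>l\<close> up to
  \<open>N\<close> occurs in \<open>hyp_poly_two_variables\<close>, and \<open>l = N\<close> in
  \<open>form_eval_alternating\<close>.\<close>

lemma vandermonde_pochhammer:
  fixes p q :: real
  assumes "p > 0" "q > 0" "l \<le> N"
  shows "(\<Sum>j\<le>l. 1 / (fact j * fact (l - j) * pochhammer q j * pochhammer p (N - j)))
       = pochhammer (real N + p + q - 1) l / (fact l * pochhammer q l * pochhammer p N)"
proof -
  have pos: "pochhammer p k > 0" "pochhammer q k > 0" for k
    using assms by (auto intro: pochhammer_pos)
  have "1 / (fact j * fact (l - j) * pochhammer q j * pochhammer p (N - j))
      = (p + real N - 1 gchoose j) * (q + real l - 1 gchoose (l - j)) / (pochhammer q l * pochhammer p N)"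
    if "j \<le> l" for j
  proof -
    have 1: "pochhammer p N = pochhammer p (N - j) * pochhammer (p + real (N - j)) j"
      using pochhammer_product[of "N - j" N p] that assms by simp
    have 2: "pochhammer q l = pochhammer q j * pochhammer (q + real j) (l - j)"
      using pochhammer_product[of j l q] that by simp
    have 3: "(p + real N - 1 gchoose j) = pochhammer (p + real (N - j)) j / fact j"
      using that assms by (simp add: gbinomial_pochhammer' of_nat_diff algebra_simps)
    have 4: "(q + real l - 1 gchoose (l - j)) = pochhammer (q + real j) (l - j) / fact (l - j)"
      using that by (simp add: gbinomial_pochhammer' of_nat_diff algebra_simps)
    have "pochhammer (p + real (N - j)) j > 0" "pochhammer (q + real j) (l - j) > 0"
      using assms by (auto intro!: pochhammer_pos)
    then show ?thesis
      unfolding 1 2 3 4 using pos[of j] pos[of "N - j"] by (simp add: field_simps)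
  qed
  then have "(\<Sum>j\<le>l. 1 / (fact j * fact (l - j) * pochhammer q j * pochhammer p (N - j)))
      = (\<Sum>j\<in>{0..l}. (p + real N - 1 gchoose j) * (q + real l - 1 gchoose (l - j)))
          / (pochhammer q l * pochhammer p N)"
    by (simp add: sum_divide_distrib atLeast0AtMost)
  also have "\<dots> = ((p + real N - 1) + (q + real l - 1) gchoose l) / (pochhammer q l * pochhammer p N)"
    by (simp only: gbinomial_Vandermonde)
  also have "((p + real N - 1) + (q + real l - 1) gchoose l) = pochhammer (real N + p + q - 1) l / fact l"
    by (simp add: gbinomial_pochhammer' algebra_simps)
  finally show ?thesis
    by simp
qed

text \<open>The left-hand side is the part of degree \<open>N\<close> of
  \<open>hyp0F1 p (U (1 - y)) * hyp0F1 q (V y)\<close> at \<open>U = 1\<close>,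
  \<open>V = -1\<close>. Expanding the powers of \<open>1 - y\<close> and collecting powers of
  \<open>y\<close> leaves inner sums of Vandermonde type.\<close>

lemma hyp_poly_two_variables:
  fixes p q y :: real
  assumes "p > 0" "q > 0"
  shows "(\<Sum>k\<le>N. (1 - y) ^ k * (- y) ^ (N - k)
            / (fact k * fact (N - k) * pochhammer p k * pochhammer q (N - k)))
       = hyp_poly N (real N + p + q - 1) q y / (fact N * pochhammer p N)"
proof -
  have pos: "pochhammer p k > 0" "pochhammer q k > 0" for k
    using assms by (auto intro: pochhammer_pos)
  define g where "g = (\<lambda>j i. (- y) ^ (j + i) /
      (fact j * fact i * fact (N - (j + i)) * pochhammer q j * pochhammer p (N - j)))"
  have "(\<Sum>k\<le>N. (1 - y) ^ k * (- y) ^ (N - k)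
            / (fact k * fact (N - k) * pochhammer p k * pochhammer q (N - k)))
      = (\<Sum>j\<le>N. (1 - y) ^ (N - j) * (- y) ^ j
            / (fact j * fact (N - j) * pochhammer p (N - j) * pochhammer q j))"
    by (rule sum.reindex_bij_witness[of _ "\<lambda>j. N - j" "\<lambda>j. N - j"]) auto
  also have "\<dots> = (\<Sum>j\<le>N. \<Sum>i\<le>N - j. g j i)"
  proof (rule sum.cong[OF refl])
    fix j assume "j \<in> {..N}"
    have "(1 - y) ^ (N - j) = (- y + 1) ^ (N - j)"
      by (simp add: algebra_simps)
    also have "\<dots> = (\<Sum>i\<le>N - j. real (N - j choose i) * (- y) ^ i)"
      by (subst binomial_ring) simp
    also have "\<dots> = (\<Sum>i\<le>N - j. fact (N - j) / (fact i * fact (N - (j + i))) * (- y) ^ i)"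
      by (rule sum.cong[OF refl]) (simp add: binomial_fact)
    finally have e: "(1 - y) ^ (N - j) = \<dots>" .
    show "(1 - y) ^ (N - j) * (- y) ^ j
            / (fact j * fact (N - j) * pochhammer p (N - j) * pochhammer q j) = (\<Sum>i\<le>N - j. g j i)"
      unfolding e sum_distrib_right sum_divide_distrib g_def
      by (rule sum.cong[OF refl]) (simp add: power_add ac_simps)
  qed
  also have "\<dots> = (\<Sum>(i, j)\<in>{(i, j). i + j \<le> N}. g i j)"
    by (simp add: sum.Sigma) (rule sum.cong, auto)
  also have "\<dots> = (\<Sum>l\<le>N. \<Sum>j\<le>l. g j (l - j))"
    by (rule sum.triangle_reindex_eq)
  also have "\<dots> = (\<Sum>l\<le>N. (- y) ^ l / fact (N - l) *
      (pochhammer (real N + p + q - 1) l / (fact l * pochhammer q l * pochhammer p N)))"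
  proof (rule sum.cong[OF refl])
    fix l assume l: "l \<in> {..N}"
    have "(\<Sum>j\<le>l. g j (l - j)) = (- y) ^ l / fact (N - l) *
       (\<Sum>j\<le>l. 1 / (fact j * fact (l - j) * pochhammer q j * pochhammer p (N - j)))"
      unfolding sum_distrib_left g_def by (rule sum.cong[OF refl]) simp
    then show "(\<Sum>j\<le>l. g j (l - j)) = (- y) ^ l / fact (N - l) *
      (pochhammer (real N + p + q - 1) l / (fact l * pochhammer q l * pochhammer p N))"
      using vandermonde_pochhammer[OF assms, of l N] l by simp
  qed
  also have "\<dots> = hyp_poly N (real N + p + q - 1) q y / (fact N * pochhammer p N)"
    unfolding hyp_poly_def sum_divide_distrib
  proof (rule sum.cong[OF refl])
    fix l assume l: "l \<in> {..N}"
    then have "real (N choose l) = fact N / (fact l * fact (N - l))"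
      by (simp add: binomial_fact)
    moreover have "(- y) ^ l = (-1) ^ l * y ^ l"
      by (rule power_minus)
    ultimately show "(- y) ^ l / fact (N - l) *
      (pochhammer (real N + p + q - 1) l / (fact l * pochhammer q l * pochhammer p N))
      = of_real ((-1) ^ l * real (N choose l) * pochhammer (real N + p + q - 1) l / pochhammer q l)
         * y ^ l / (fact N * pochhammer p N)"
      using pos[of l] pos[of N] by (simp add: field_simps)
  qed
  finally show ?thesis .
qed

section \<open>Two-variable forms and their harmonic decomposition\<close>

text \<open>
  With this normalization of the coefficients the Laplacian sends \<open>a\<close> to \<open>\<lambda>k. a k + a (k + 1)\<close>, so the
  harmonic forms are the multiples of the alternating one.
\<close>

definition form_eval :: "real \<Rightarrow> real \<Rightarrow> nat \<Rightarrow> (nat \<Rightarrow> real) \<Rightarrow> 'a \<Rightarrow> 'a \<Rightarrow> 'a::real_normed_field" where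
  "form_eval p q N a U V = (\<Sum>k\<le>N. of_real (a k) * (U ^ k / of_real (fact k * pochhammer p k))
      * (V ^ (N - k) / of_real (fact (N - k) * pochhammer q (N - k))))"

text \<open>The coefficients of \<open>(U + V) ^ m\<close> times the harmonic form of degree \<open>n\<close>.\<close>

fun harm_coeff :: "real \<Rightarrow> real \<Rightarrow> nat \<Rightarrow> nat \<Rightarrow> nat \<Rightarrow> real" where
  "harm_coeff p q n 0 k = (-1) ^ (n + k)"
| "harm_coeff p q n (Suc m) k =
     real k * (p + real k - 1) * harm_coeff p q n m (k - 1)
     + (real m + real n + 1 - real k) * (q + real m + real n - real k) * harm_coeff p q n m k"

text \<open>For a harmonic \<open>H\<close> of degree \<open>n\<close>, the product rule and Euler's
  identity give that the Laplacian of \<open>(U + V) ^ (m + 1) H\<close> is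
  \<open>(m + 1) (m + p + q + 2 n) (U + V) ^ m H\<close>. The induction is the same computation on
  coefficients: it commutes the Laplacian past one multiplication by \<open>U + V\<close>.\<close>

lemma harm_coeff_laplacian:
  "harm_coeff p q n (Suc m) (Suc k) + harm_coeff p q n (Suc m) k
    = (real m + 1) * (real m + p + q + 2 * real n) * harm_coeff p q n m k"
proof (induction m arbitrary: k)
  case 0
  show ?case
    by (cases k) (simp_all add: algebra_simps)
next
  case (Suc m)
  define c where "c = (real m + 1) * (real m + p + q + 2 * real n)"
  define f where "f = harm_coeff p q n m"
  define g where "g = harm_coeff p q n (Suc m)"
  have g: "g k = real k * (p + real k - 1) * f (k - 1)
     + (real m + real n + 1 - real k) * (q + real m + real n - real k) * f k"
    by (simp add: g_def f_def)
  have 1: "g (Suc k) = c * f k - g k"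
    using Suc.IH[of k] by (simp add: g_def c_def f_def)
  \<comment> \<open>The induction hypothesis at \<open>k - 1\<close>; the factor \<open>k\<close>
    makes it valid at \<open>k = 0\<close> too, where \<open>k - 1\<close> is truncated.\<close>
  have 2: "real k * g (k - 1) = real k * (c * f (k - 1) - g k)"
    using Suc.IH[of "k - 1"] by (cases k) (simp_all add: g_def c_def f_def)
  have "harm_coeff p q n (Suc (Suc m)) (Suc k) + harm_coeff p q n (Suc (Suc m)) k
    = (real k + 1) * (p + real k) * g k
      + (real m + 1 + real n - real k) * (q + real m + real n - real k) * g (Suc k)
      + (p + real k - 1) * (real k * g (k - 1))
      + (real m + 2 + real n - real k) * (q + real m + 1 + real n - real k) * g k"
    unfolding harm_coeff.simps(2)[of p q n "Suc m"] g_def[symmetric]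
    by (simp add: algebra_simps)
  also have "\<dots> = (p + q + 2 * real m + 2 + 2 * real n) * g k
      + c * (real k * (p + real k - 1) * f (k - 1)
        + (real m + real n + 1 - real k) * (q + real m + real n - real k) * f k)"
    unfolding 1 2 by (simp add: algebra_simps)
  also have "\<dots> = (p + q + 2 * real m + 2 + 2 * real n + c) * g k"
    unfolding g[symmetric] by (simp add: algebra_simps)
  also have "p + q + 2 * real m + 2 + 2 * real n + c
      = (real (Suc m) + 1) * (real (Suc m) + p + q + 2 * real n)"
    by (simp add: c_def algebra_simps)
  finally show ?case
    by (simp only: g_def)
qed

text \<open>In the normalized basis, \<open>U u_k = (k + 1) (p + k) u_(k+1)\<close> and likewise for
  \<open>V\<close>, so the two summands of the recursion for \<open>harm_coeff\<close> are
  multiplication by \<open>U\<close> and by \<open>V\<close>. Their weights vanish at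
  \<open>k = 0\<close> and at \<open>k = N + 1\<close> respectively, so both sums run over the same
  range.\<close>

lemma form_eval_harm_coeff_Suc:
  assumes "p > 0" "q > 0"
  shows "form_eval p q (n + Suc m) (harm_coeff p q n (Suc m)) U V
       = (U + V) * form_eval p q (n + m) (harm_coeff p q n m) U V"
proof -
  define N where "N = n + m"
  define a where "a = harm_coeff p q n m"
  define u where "u = (\<lambda>k. U ^ k / of_real (fact k * pochhammer p k))"
  define v where "v = (\<lambda>k. V ^ k / of_real (fact k * pochhammer q k))"
  have pos: "pochhammer p k > 0" "pochhammer q k > 0" for k
    using assms by (auto intro: pochhammer_pos)
  have u: "of_real (real (Suc k) * (p + real k)) * u (Suc k) = U * u k" for k
  proof -
    have "p + real k \<noteq> 0" "pochhammer p k \<noteq> 0"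
      using assms pos[of k] by auto
    then show ?thesis
      unfolding u_def by (simp add: pochhammer_rec' divide_simps del: of_real_add of_real_mult of_real_of_nat_eq)
        (simp add: algebra_simps)
  qed
  have v: "of_real (real (Suc k) * (q + real k)) * v (Suc k) = V * v k" for k
  proof -
    have "q + real k \<noteq> 0" "pochhammer q k \<noteq> 0"
      using assms pos[of k] by auto
    then show ?thesis
      unfolding v_def by (simp add: pochhammer_rec' divide_simps del: of_real_add of_real_mult of_real_of_nat_eq)
        (simp add: algebra_simps)
  qed
  have b: "harm_coeff p q n (Suc m) k = real k * (p + real k - 1) * a (k - 1)
     + (real N + 1 - real k) * (q + real N - real k) * a k" for k
    by (simp add: a_def N_def algebra_simps)
  have "form_eval p q (Suc N) (harm_coeff p q n (Suc m)) U V
      = (\<Sum>k\<le>Suc N. of_real (real k * (p + real k - 1) * a (k - 1)) * u k * v (Suc N - k))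
        + (\<Sum>k\<le>Suc N. of_real ((real N + 1 - real k) * (q + real N - real k) * a k) * u k * v (Suc N - k))"
    unfolding form_eval_def b u_def[symmetric] v_def[symmetric] of_real_add
    by (simp only: sum.distrib distrib_right u_def v_def)
  also have "(\<Sum>k\<le>Suc N. of_real (real k * (p + real k - 1) * a (k - 1)) * u k * v (Suc N - k))
      = (\<Sum>k\<le>N. of_real (a k) * (of_real (real (Suc k) * (p + real k)) * u (Suc k)) * v (N - k))"
    by (subst sum.atMost_Suc_shift) (simp add: ac_simps)
  also have "\<dots> = U * (\<Sum>k\<le>N. of_real (a k) * u k * v (N - k))"
    unfolding u sum_distrib_left by (simp add: ac_simps)
  also have "(\<Sum>k\<le>Suc N. of_real ((real N + 1 - real k) * (q + real N - real k) * a k) * u k * v (Suc N - k))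
      = (\<Sum>k\<le>N. of_real (a k) * u k * (of_real (real (Suc (N - k)) * (q + real (N - k))) * v (Suc (N - k))))"
    by (simp, rule sum.cong[OF refl]) (simp add: of_nat_diff Suc_diff_le algebra_simps)
  also have "\<dots> = V * (\<Sum>k\<le>N. of_real (a k) * u k * v (N - k))"
    unfolding v sum_distrib_left by (simp add: ac_simps)
  finally show ?thesis
    by (simp add: form_eval_def N_def a_def u_def v_def distrib_right)
qed

lemma form_eval_harm_coeff:
  assumes "p > 0" "q > 0"
  shows "form_eval p q (n + m) (harm_coeff p q n m) U V
       = (U + V) ^ m * form_eval p q n (\<lambda>k. (-1) ^ (n + k)) U V"
proof (induction m)
  case 0
  then show ?case
    by (simp add: form_eval_def)
next
  case (Suc m)
  then show ?case
    using form_eval_harm_coeff_Suc[OF assms, of n m U V] by (simp del: harm_coeff.simps)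
qed

lemma form_eval_sum:
  "form_eval p q N (\<lambda>k. \<Sum>n\<in>I. c n * a n k) U V
     = (\<Sum>n\<in>I. of_real (c n) * form_eval p q N (a n) U V)"
  unfolding form_eval_def of_real_sum sum_distrib_right sum_distrib_left
  by (subst sum.swap) (simp add: ac_simps)

lemma form_eval_diff:
  "form_eval p q N (\<lambda>k. a k - b k) U V = form_eval p q N a U V - form_eval p q N b U V"
  by (simp only: form_eval_def of_real_diff left_diff_distrib sum_subtractf)

lemma form_eval_cong:
  "(\<And>k. k \<le> N \<Longrightarrow> a k = b k) \<Longrightarrow> form_eval p q N a U V = form_eval p q N b U V"
  unfolding form_eval_def by (intro sum.cong) auto

text \<open>At \<open>(1, -1)\<close> the signs of the coefficients cancel those of the powers of
  \<open>V\<close>. All terms are then positive, so a multiple of the alternating sequence can be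
  recognized as zero from this single value.\<close>

lemma form_eval_alternating:
  assumes "p > 0" "q > 0"
  shows "form_eval p q N (\<lambda>k. (-1) ^ (N + k)) 1 (-1 :: real)
       = pochhammer (real N + p + q - 1) N / (fact N * pochhammer p N * pochhammer q N)"
proof -
  have "form_eval p q N (\<lambda>k. (-1) ^ (N + k)) 1 (-1 :: real)
      = (\<Sum>k\<le>N. 1 / (fact k * fact (N - k) * pochhammer p k * pochhammer q (N - k)))"
    unfolding form_eval_def
  proof (rule sum.cong[OF refl])
    fix k assume "k \<in> {..N}"
    then have "(-1) ^ (N + k) * (-1) ^ (N - k) = (1 :: real)"
      by (simp add: power_add[symmetric])
    then show "of_real ((-1) ^ (N + k)) * (1 ^ k / of_real (fact k * pochhammer p k))
        * ((- 1) ^ (N - k) / of_real (fact (N - k) * pochhammer q (N - k)))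
        = 1 / (fact k * fact (N - k) * pochhammer p k * pochhammer q (N - k))"
      by simp
  qed
  then show ?thesis
    using vandermonde_pochhammer[of q p N N] assms by (simp add: ac_simps)
qed

text \<open>Since \<open>1 - y\<close> and \<open>y\<close> add up to 1, adding the entries at
  \<open>k\<close> and \<open>k + 1\<close> of the left-hand side for degree \<open>N\<close> gives
  the entry at \<open>k\<close> for degree \<open>N - 1\<close>. By
  \<open>harm_coeff_laplacian\<close> the right-hand side behaves in the same way.\<close>

lemma monomial_harmonic_expansion:
  fixes p q y :: real
  assumes "p > 0" "q > 0" "k \<le> N"
  shows "(1 - y) ^ k * y ^ (N - k) =
    (\<Sum>n\<le>N. pochhammer q n / pochhammer (real n + p + q - 1) n * hyp_poly n (real n + p + q - 1) q y
       / (fact (N - n) * pochhammer (p + q + 2 * real n) (N - n)) * harm_coeff p q n (N - n) k)"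
  using assms(3)
proof (induction N arbitrary: k rule: less_induct)
  case (less N)
  \<comment> \<open>The weight \<open>w n\<close> is the value in
    \<open>hyp_poly_two_variables\<close> divided by the one in
    \<open>form_eval_alternating\<close>; \<open>r n m\<close> is the product of the factors that
    \<open>m\<close> Laplacians produce by \<open>harm_coeff_laplacian\<close>.\<close>
  define w where "w = (\<lambda>n. pochhammer q n / pochhammer (real n + p + q - 1) n
      * hyp_poly n (real n + p + q - 1) q y)"
  define r where "r = (\<lambda>n m. fact m * pochhammer (p + q + 2 * real n) m)"
  define R where "R = (\<lambda>N k. \<Sum>n\<le>N. w n / r n (N - n) * harm_coeff p q n (N - n) k)"
  define D where "D = (\<lambda>k. (1 - y) ^ k * y ^ (N - k) - R N k)"
  have pos: "pochhammer p k > 0" "pochhammer q k > 0" for k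
    using assms by (auto intro: pochhammer_pos)
  have rpos: "r n m > 0" for n m
    unfolding r_def using assms by (intro mult_pos_pos pochhammer_pos) auto
  have IH: "(1 - y) ^ k * y ^ (N' - k) = R N' k" if "N' < N" "k \<le> N'" for N' k
    using less.IH[OF that] unfolding R_def w_def r_def by simp
  have step: "D (Suc k) + D k = 0" if k: "k < N" for k
  proof -
    obtain N' where N: "N = Suc N'" and k': "k \<le> N'"
      using k by (cases N) auto
    have "w n / r n (N - n) * harm_coeff p q n (N - n) (Suc k)
          + w n / r n (N - n) * harm_coeff p q n (N - n) k
        = w n / r n (N' - n) * harm_coeff p q n (N' - n) k" if "n \<le> N'" for n
    proof -
      define m where "m = N' - n"
      have m: "N - n = Suc m"
        using that N by (simp add: m_def)
      have "w n / r n (N - n) * harm_coeff p q n (N - n) (Suc k)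
          + w n / r n (N - n) * harm_coeff p q n (N - n) k
          = w n / r n (Suc m) * (harm_coeff p q n (Suc m) (Suc k) + harm_coeff p q n (Suc m) k)"
        unfolding m by (simp only: distrib_left)
      also have "\<dots> = w n / r n (Suc m) * ((real m + 1) * (real m + p + q + 2 * real n)) * harm_coeff p q n m k"
        unfolding harm_coeff_laplacian by (simp only: mult.assoc)
      also have "r n (Suc m) = r n m * ((real m + 1) * (real m + p + q + 2 * real n))"
        by (simp add: r_def pochhammer_rec' algebra_simps)
      also have "w n / (r n m * ((real m + 1) * (real m + p + q + 2 * real n)))
          * ((real m + 1) * (real m + p + q + 2 * real n)) = w n / r n m"
      proof -
        have cancel: "a / (b * c) * c = a / b" if "c > 0" for a b c :: real
          using that by simp
        have "real m + p + q + 2 * real n > 0"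
          using assms by simp
        then show ?thesis
          by (intro cancel) simp
      qed
      finally show ?thesis
        by (simp add: m_def)
    qed
    then have "R N (Suc k) + R N k = R N' k"
      unfolding R_def N by (simp add: sum.distrib[symmetric])
    moreover have "(1 - y) ^ Suc k * y ^ (N - Suc k) + (1 - y) ^ k * y ^ (N - k) = (1 - y) ^ k * y ^ (N' - k)"
      using k' by (simp add: N Suc_diff_le algebra_simps)
    ultimately show ?thesis
      using IH[of N' k] k' N by (simp add: D_def)
  qed
  define d where "d = D 0"
  have alt: "D k = (-1) ^ (N + k) * ((-1) ^ N * d)" if "k \<le> N" for k
    using that
  proof (induction k)
    case 0
    show ?case
      by (simp add: d_def power_add[symmetric] mult.assoc[symmetric])
  next
    case (Suc k)
    then show ?case
      using step[of k] by simp
  qed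
  define E where "E = form_eval p q N (\<lambda>k. (-1) ^ (N + k)) 1 (-1 :: real)"
  have E: "E = pochhammer (real N + p + q - 1) N / (fact N * pochhammer p N * pochhammer q N)"
    unfolding E_def using assms(1,2) by (rule form_eval_alternating)
  \<comment> \<open>For \<open>N = 0\<close> the base \<open>p + q - 1\<close> may be negative, but
    then the Pochhammer symbol is 1.\<close>
  have Mpos: "pochhammer (real N + p + q - 1) N > 0"
    using assms by (cases N) (auto intro!: pochhammer_pos)
  \<comment> \<open>The sum over a single index casts a scalar multiple into the shape of
    \<open>form_eval_sum\<close>.\<close>
  have "form_eval p q N D 1 (-1) = form_eval p q N (\<lambda>k. \<Sum>n\<in>{0::nat}. ((-1) ^ N * d) * (-1) ^ (N + k)) 1 (-1 :: real)"
    by (rule form_eval_cong) (simp add: alt)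
  also have "\<dots> = (-1) ^ N * d * E"
    unfolding form_eval_sum by (simp add: E_def)
  finally have 1: "form_eval p q N D 1 (-1) = (-1) ^ N * d * E" .
  have "form_eval p q N D 1 (-1) = form_eval p q N (\<lambda>k. (1 - y) ^ k * y ^ (N - k)) 1 (-1)
      - (\<Sum>n\<le>N. w n / r n (N - n) * form_eval p q N (harm_coeff p q n (N - n)) 1 (-1))"
    unfolding D_def form_eval_diff R_def form_eval_sum by simp
  also have "form_eval p q N (\<lambda>k. (1 - y) ^ k * y ^ (N - k)) 1 (-1)
      = (\<Sum>k\<le>N. (1 - y) ^ k * (- y) ^ (N - k)
            / (fact k * fact (N - k) * pochhammer p k * pochhammer q (N - k)))"
    unfolding form_eval_def by (rule sum.cong[OF refl]) (simp add: power_minus[of y] ac_simps)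
  also have "\<dots> = hyp_poly N (real N + p + q - 1) q y / (fact N * pochhammer p N)"
    using assms by (intro hyp_poly_two_variables)
  also have "\<dots> = w N * E"
    unfolding w_def E using pos[of N] Mpos by (simp add: field_simps)
  also have "(\<Sum>n\<le>N. w n / r n (N - n) * form_eval p q N (harm_coeff p q n (N - n)) 1 (-1)) = 
      (\<Sum>n\<le>N. if n = N then w N * E else 0)"
  proof (rule sum.cong[OF refl])
    fix n assume n: "n \<in> {..N}"
    \<comment> \<open>Since \<open>U + V = 0\<close> at this point, only the summand without a power
      of \<open>U + V\<close> survives.\<close>
    have "form_eval p q N (harm_coeff p q n (N - n)) 1 (-1)
        = 0 ^ (N - n) * form_eval p q n (\<lambda>k. (-1) ^ (n + k)) 1 (-1 :: real)"
      using form_eval_harm_coeff[of p q n "N - n" 1 "-1 :: real"] assms n by simp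
    then show "w n / r n (N - n) * form_eval p q N (harm_coeff p q n (N - n)) 1 (-1)
        = (if n = N then w N * E else 0)"
      using n by (auto simp: r_def E_def)
  qed
  also have "\<dots> = w N * E"
    by simp
  finally have "(-1) ^ N * d * E = 0"
    using 1 by simp
  moreover have "E > 0"
    unfolding E using Mpos pos[of N] by simp
  ultimately have "D k = 0"
    using alt[OF less.prems] by simp
  then show ?case
    unfolding D_def R_def w_def r_def by simp
qed

section \<open>Bounds for Pochhammer symbols, 0F1 and the terms of Bateman's series\<close>

lemma pochhammer_mono_base:
  fixes a b :: real
  assumes "0 \<le> a" "a \<le> b"
  shows "pochhammer a n \<le> pochhammer b n"
  unfolding pochhammer_prod using assms by (intro prod_mono) auto

text \<open>For \<open>b < 1\<close> the Pochhammer symbol can fall below the factorial;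
  \<open>C\<close> makes up for this, since the two hypotheses give
  \<open>1 + k \<le> C (b + k)\<close> for each factor.\<close>

lemma fact_le_power_pochhammer:
  fixes b C :: real
  assumes "C \<ge> 1" "C * b \<ge> 1"
  shows "fact n \<le> C ^ n * pochhammer b n"
proof (induction n)
  case (Suc n)
  have "real n \<le> C * real n"
    using assms by (simp add: mult_right_mono[of 1 C "real n", simplified])
  then have "1 + real n \<le> C * (b + real n)"
    using assms by (simp add: distrib_left)
  moreover have "C ^ n * pochhammer b n \<ge> 0"
    using Suc.IH by (smt (verit) fact_ge_zero)
  ultimately have "(1 + real n) * fact n \<le> (C * (b + real n)) * (C ^ n * pochhammer b n)"
    using Suc.IH by (intro mult_mono) auto
  then show ?case
    by (simp add: pochhammer_Suc ac_simps)
qed simp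

lemma inverse_pochhammer_le:
  fixes b C :: real
  assumes "C \<ge> 1" "C * b \<ge> 1"
  shows "1 / pochhammer b n \<le> C ^ n"
proof -
  have "b > 0"
    using assms by (smt (verit) mult_nonneg_nonpos)
  then have "pochhammer b n > 0"
    by (rule pochhammer_pos)
  moreover have "1 \<le> C ^ n * pochhammer b n"
    using fact_le_power_pochhammer[OF assms, of n] fact_ge_1[of n, where 'a = real] by linarith
  ultimately show ?thesis
    by (simp add: field_simps)
qed

lemma hyp0F1_eq: "hyp0F1 b z = (\<Sum>k. z ^ k / of_real (fact k * pochhammer b k))"
  unfolding hyp0F1_def eval_fps_def
  by (simp add: pochhammer_of_real divide_inverse ac_simps)

lemma norm_hyp0F1_term_le:
  fixes z :: "'a::{real_normed_field, banach}"
  assumes "C \<ge> 1" "C * b \<ge> 1"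
  shows "norm (z ^ k / of_real (fact k * pochhammer b k)) \<le> (C * norm z) ^ k / fact k"
proof -
  have "b > 0"
    using assms by (smt (verit) mult_nonneg_nonpos)
  then have "pochhammer b k > 0"
    by (rule pochhammer_pos)
  then have "norm (z ^ k / of_real (fact k * pochhammer b k)) = norm z ^ k / fact k * (1 / pochhammer b k)"
    by (simp add: norm_divide norm_power norm_mult)
  also have "\<dots> \<le> norm z ^ k / fact k * C ^ k"
    by (intro mult_left_mono inverse_pochhammer_le assms) auto
  finally show ?thesis
    by (simp add: power_mult_distrib mult.commute)
qed

lemma summable_power_div_fact: "summable (\<lambda>k. x ^ k / fact k :: real)"
  using summable_exp[of x] by (simp add: divide_inverse mult.commute)

lemma suminf_power_div_fact: "(\<Sum>k. x ^ k / fact k :: real) = exp x"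
  by (simp add: exp_def divide_inverse mult.commute)

lemma
  fixes z :: "'a::{real_normed_field, banach}"
  assumes "C \<ge> 1" "C * b \<ge> 1"
  shows summable_norm_hyp0F1: "summable (\<lambda>k. norm (z ^ k / of_real (fact k * pochhammer b k)))"
    and norm_hyp0F1_le: "norm (hyp0F1 b z) \<le> exp (C * norm z)"
proof -
  show 1: "summable (\<lambda>k. norm (z ^ k / of_real (fact k * pochhammer b k)))"
    using norm_hyp0F1_term_le[OF assms]
    by (intro summable_comparison_test'[OF summable_power_div_fact[of "C * norm z"], of 0]) simp
  have "norm (hyp0F1 b z) \<le> (\<Sum>k. norm (z ^ k / of_real (fact k * pochhammer b k)))"
    unfolding hyp0F1_eq by (rule summable_norm[OF 1])
  also have "\<dots> \<le> (\<Sum>k. (C * norm z) ^ k / fact k)"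
    by (intro suminf_le norm_hyp0F1_term_le assms 1 summable_power_div_fact)
  finally show "norm (hyp0F1 b z) \<le> exp (C * norm z)"
    unfolding suminf_power_div_fact .
qed

lemma norm_form_eval_alternating_le:
  fixes U V :: "'a::real_normed_field"
  assumes "C \<ge> 1" "C * p \<ge> 1" "C * q \<ge> 1"
  shows "norm (form_eval p q n (\<lambda>k. (-1) ^ (n + k)) U V) \<le> (C * (norm U + norm V)) ^ n / fact n"
proof -
  have pq: "p > 0" "q > 0"
    using assms by (smt (verit) mult_nonneg_nonpos)+
  then have pos: "pochhammer p k > 0" "pochhammer q k > 0" for k
    by (auto intro: pochhammer_pos)
  have "norm (form_eval p q n (\<lambda>k. (-1) ^ (n + k)) U V)
      \<le> (\<Sum>k\<le>n. C ^ n / fact n * (real (n choose k) * norm U ^ k * norm V ^ (n - k)))"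
    unfolding form_eval_def
  proof (rule sum_norm_le)
    fix k assume k: "k \<in> {..n}"
    have "norm (of_real ((-1) ^ (n + k)) * (U ^ k / of_real (fact k * pochhammer p k))
      * (V ^ (n - k) / of_real (fact (n - k) * pochhammer q (n - k))))
      = (1 / pochhammer p k) * (1 / pochhammer q (n - k))
        * (norm U ^ k * norm V ^ (n - k) / (fact k * fact (n - k)))"
      using pos[of k] pos[of "n - k"] by (simp add: norm_mult norm_divide norm_power)
    also have "\<dots> \<le> C ^ k * C ^ (n - k) * (norm U ^ k * norm V ^ (n - k) / (fact k * fact (n - k)))"
      using pos[of "n - k"] assms
      by (intro mult_right_mono mult_mono inverse_pochhammer_le) auto
    also have "C ^ k * C ^ (n - k) = C ^ n"
      using k by (simp add: power_add[symmetric])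
    also have "C ^ n * (norm U ^ k * norm V ^ (n - k) / (fact k * fact (n - k)))
      = C ^ n / fact n * (real (n choose k) * norm U ^ k * norm V ^ (n - k))"
      using k by (simp add: binomial_fact)
    finally show "norm (of_real ((-1) ^ (n + k)) * (U ^ k / of_real (fact k * pochhammer p k))
      * (V ^ (n - k) / of_real (fact (n - k) * pochhammer q (n - k)))) \<le> \<dots>" .
  qed
  also have "\<dots> = C ^ n / fact n * (norm U + norm V) ^ n"
    unfolding sum_distrib_left[symmetric] by (simp add: binomial_ring)
  finally show ?thesis
    by (simp add: power_mult_distrib)
qed

text \<open>The base \<open>r = n + p + q - 1\<close> grows with \<open>n\<close>, but the weight
  compensates: \<open>q \<le> r\<close> makes each ratio of Pochhammer symbols at most 1, and a
  binomial sum in \<open>\<bar>y\<bar>\<close> remains. The case \<open>n = 0\<close> is separate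
  because there \<open>q \<le> r\<close> can fail.\<close>

lemma abs_jacobi_weight_le:
  fixes p q y :: real
  assumes "p > 0" "q > 0"
  shows "\<bar>pochhammer q n / pochhammer (real n + p + q - 1) n * hyp_poly n (real n + p + q - 1) q y\<bar>
      \<le> (1 + \<bar>y\<bar>) ^ n"
proof (cases n)
  case 0
  then show ?thesis
    by (simp add: hyp_poly_def)
next
  case (Suc n')
  define r where "r = real n + p + q - 1"
  have r: "r > 0" "q \<le> r"
    using Suc assms by (auto simp: r_def)
  have pos: "pochhammer q k > 0" "pochhammer r k > 0" for k
    using assms r by (auto intro: pochhammer_pos)
  have "\<bar>pochhammer q n / pochhammer r n * hyp_poly n r q y\<bar>
      = \<bar>\<Sum>k\<le>n. pochhammer q n / pochhammer r n *
         (((-1) ^ k * real (n choose k) * pochhammer r k / pochhammer q k) * y ^ k)\<bar>"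
    by (simp add: hyp_poly_def sum_distrib_left)
  also have "\<dots> \<le> (\<Sum>k\<le>n. real (n choose k) * \<bar>y\<bar> ^ k)"
  proof (rule order_trans[OF sum_abs], rule sum_mono)
    fix k assume k: "k \<in> {..n}"
    have "pochhammer q n * pochhammer r k
        = pochhammer q k * pochhammer r k * pochhammer (q + real k) (n - k)"
      using k pochhammer_product[of k n q] by simp
    also have "\<dots> \<le> pochhammer q k * pochhammer r k * pochhammer (r + real k) (n - k)"
      using pos[of k] r assms by (intro mult_left_mono pochhammer_mono_base) auto
    also have "\<dots> = pochhammer q k * pochhammer r n"
      using k pochhammer_product[of k n r] by simp
    finally have "pochhammer q n / pochhammer r n * (pochhammer r k / pochhammer q k) \<le> 1"
      using pos[of k] pos[of n] by (simp add: field_simps)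
    then have "pochhammer q n / pochhammer r n * (pochhammer r k / pochhammer q k)
        * (real (n choose k) * \<bar>y\<bar> ^ k) \<le> 1 * (real (n choose k) * \<bar>y\<bar> ^ k)"
      by (intro mult_right_mono) auto
    then show "\<bar>pochhammer q n / pochhammer r n *
         (((-1) ^ k * real (n choose k) * pochhammer r k / pochhammer q k) * y ^ k)\<bar>
       \<le> real (n choose k) * \<bar>y\<bar> ^ k"
      using pos[of k] pos[of n] by (simp add: abs_mult power_abs ac_simps)
  qed
  also have "\<dots> = (1 + \<bar>y\<bar>) ^ n"
    by (subst add.commute, subst binomial_ring) simp
  finally show ?thesis
    by (simp add: r_def)
qed

text \<open>The dominating product is summable on the whole grid, so \<open>T\<close> has an
  unconditional sum, which may be taken by rows or by antidiagonals.\<close>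

lemma has_sum_product_regroup:
  fixes T :: "nat \<times> nat \<Rightarrow> 'a::banach"
  assumes f: "summable f" "\<And>n. f n \<ge> (0::real)"
    and g: "summable g" "\<And>m. g m \<ge> (0::real)"
    and T: "\<And>n m. norm (T (n, m)) \<le> f n * g m"
  obtains S where "(\<lambda>n. \<Sum>m. T (n, m)) sums S" "(\<lambda>N. \<Sum>n\<le>N. T (n, N - n)) sums S"
proof -
  have g': "(g has_sum suminf g) UNIV"
    using g by (intro sums_nonneg_imp_has_sum) (auto simp: summable_sums)
  have f': "f summable_on UNIV"
    using f sums_nonneg_imp_has_sum[of f "suminf f"] by (auto simp: summable_on_def summable_sums)
  have "(\<lambda>(n, m). f n * g m) summable_on (UNIV \<times> UNIV)"
    using f g by (intro summable_on_SigmaI[where g = "\<lambda>n. f n * suminf g"])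
      (auto intro!: has_sum_cmult_right g' summable_on_cmult_left f')
  then have "(\<lambda>(n, m). f n * g m) summable_on UNIV"
    by simp
  then have "(\<lambda>x. norm (T x)) summable_on UNIV"
    by (rule Infinite_Sum.abs_summable_on_comparison_test'[where g = "\<lambda>(n, m). f n * g m"]) (use T in auto)
  then have "T summable_on UNIV"
    by (rule abs_summable_summable)
  then obtain S where S: "(T has_sum S) UNIV"
    by (auto simp: summable_on_def)
  have inner: "((\<lambda>m. T (n, m)) has_sum (\<Sum>m. T (n, m))) UNIV" for n
  proof -
    have "summable (\<lambda>m. norm (T (n, m)))"
      using T by (intro summable_comparison_test'[OF summable_mult[OF g(1), of "f n"], of 0]) auto
    then show ?thesis
      by (intro norm_summable_imp_has_sum) (auto intro: summable_sums summable_norm_cancel)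
  qed
  have "((\<lambda>n. \<Sum>m. T (n, m)) has_sum S) UNIV"
    using has_sum_SigmaD[where f = T and S = S and A = UNIV and B = "\<lambda>_. UNIV"] S inner by simp
  moreover have "((\<lambda>(N, n). T (n, N - n)) has_sum S) (Sigma UNIV (\<lambda>N. {..N})) \<longleftrightarrow> (T has_sum S) UNIV"
    by (rule has_sum_reindex_bij_witness[where i = "\<lambda>(n, m). (n + m, n)"
          and j = "\<lambda>(N, n). (n, N - n)"]) auto
  then have "((\<lambda>(N, n). T (n, N - n)) has_sum S) (Sigma UNIV (\<lambda>N. {..N}))"
    using S by simp
  then have "((\<lambda>N. \<Sum>n\<le>N. T (n, N - n)) has_sum S) UNIV"
    by (rule has_sum_SigmaD) (auto intro: has_sum_finite)
  ultimately show ?thesis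
    using that by (blast intro: has_sum_imp_sums)
qed

section \<open>Bateman's series\<close>

lemma bateman_expansion_form_eval:
  fixes U V :: "'a::{real_normed_field, banach}" and p q y :: real
  assumes "p > 0" "q > 0"
  shows "(\<lambda>n. of_real (pochhammer q n / pochhammer (real n + p + q - 1) n
              * hyp_poly n (real n + p + q - 1) q y)
          * form_eval p q n (\<lambda>k. (-1) ^ (n + k)) U V * hyp0F1 (p + q + 2 * real n) (U + V))
     sums (hyp0F1 p (U * of_real (1 - y)) * hyp0F1 q (V * of_real y))"
proof -
  define C where "C = max 1 (max (1 / p) (1 / q))"
  have C: "C \<ge> 1" "C * p \<ge> 1" "C * q \<ge> 1"
    using assms mult_right_mono[of "1 / p" C p] mult_right_mono[of "1 / q" C q]
    by (auto simp: C_def)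
  have Cpq: "C * (p + q + 2 * real n) \<ge> 1" for n
  proof -
    have "C * (p + q + 2 * real n) = C * p + (C * q + C * (2 * real n))"
      by (simp add: algebra_simps)
    then show ?thesis
      using C by (smt (verit) mult_nonneg_nonneg of_nat_0_le_iff)
  qed
  define w where "w = (\<lambda>n. pochhammer q n / pochhammer (real n + p + q - 1) n
              * hyp_poly n (real n + p + q - 1) q y)"
  define H where "H = (\<lambda>n. form_eval p q n (\<lambda>k. (-1) ^ (n + k)) U V)"
  define X where "X = (\<lambda>n m. (U + V) ^ m / of_real (fact m * pochhammer (p + q + 2 * real n) m))"
  \<comment> \<open>\<open>T (n, m)\<close> is homogeneous of degree \<open>n + m\<close> in
    \<open>U\<close> and \<open>V\<close>. Rows sum to the terms of Bateman's series, antidiagonals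
    to the homogeneous parts of the product.\<close>
  define T where "T = (\<lambda>(n, m). of_real (w n) * H n * X n m)"
  define f where "f = (\<lambda>n. ((1 + \<bar>y\<bar>) * (C * (norm U + norm V))) ^ n / fact n)"
  define g where "g = (\<lambda>m. (C * norm (U + V)) ^ m / fact m)"
  have T: "norm (T (n, m)) \<le> f n * g m" for n m
  proof -
    have "norm (T (n, m)) = \<bar>w n\<bar> * norm (H n) * norm (X n m)"
      by (simp add: T_def norm_mult)
    also have "\<dots> \<le> (1 + \<bar>y\<bar>) ^ n * ((C * (norm U + norm V)) ^ n / fact n)
        * ((C * norm (U + V)) ^ m / fact m)"
      unfolding w_def H_def X_def using C Cpq[of n] assms
      by (intro mult_mono abs_jacobi_weight_le norm_form_eval_alternating_le norm_hyp0F1_term_le) auto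
    finally show ?thesis
      by (simp add: f_def g_def power_mult_distrib)
  qed
  have nonneg: "f n \<ge> 0" "g n \<ge> 0" for n
    using C by (auto simp: f_def g_def)
  have summ: "summable f" "summable g"
    unfolding f_def g_def by (rule summable_power_div_fact)+
  obtain S where S1: "(\<lambda>n. \<Sum>m. T (n, m)) sums S"
    and S2: "(\<lambda>N. \<Sum>n\<le>N. T (n, N - n)) sums S"
    using has_sum_product_regroup[of f g T] summ nonneg T by blast
  have inner: "(\<Sum>m. T (n, m)) = of_real (w n) * H n * hyp0F1 (p + q + 2 * real n) (U + V)" for n
  proof -
    have "summable (X n)"
      unfolding X_def using summable_norm_hyp0F1[OF C(1) Cpq] by (rule summable_norm_cancel)
    then have "(\<Sum>m. of_real (w n) * H n * X n m) = of_real (w n) * H n * suminf (X n)"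
      by (rule suminf_mult)
    also have "suminf (X n) = hyp0F1 (p + q + 2 * real n) (U + V)"
      by (simp only: X_def hyp0F1_eq)
    finally show ?thesis
      by (simp only: T_def prod.case)
  qed
  define a where "a = (\<lambda>k. (U * of_real (1 - y)) ^ k / of_real (fact k * pochhammer p k))"
  define b where "b = (\<lambda>k. (V * of_real y) ^ k / of_real (fact k * pochhammer q k))"
  \<comment> \<open>Both sides are the part of degree \<open>N\<close>: on the left in harmonic
    forms, on the right as a coefficient of the Cauchy product.\<close>
  have diag: "(\<Sum>n\<le>N. T (n, N - n)) = (\<Sum>k\<le>N. a k * b (N - k))" for N
  proof -
    define r where "r = (\<lambda>n. fact (N - n) * pochhammer (p + q + 2 * real n) (N - n))"
    have "(\<Sum>n\<le>N. T (n, N - n))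
        = (\<Sum>n\<le>N. of_real (w n / r n) * form_eval p q N (harm_coeff p q n (N - n)) U V)"
    proof (rule sum.cong[OF refl])
      fix n assume "n \<in> {..N}"
      then have "form_eval p q N (harm_coeff p q n (N - n)) U V = (U + V) ^ (N - n) * H n"
        using form_eval_harm_coeff[OF assms, of n "N - n" U V] by (simp add: H_def)
      then show "T (n, N - n) = of_real (w n / r n) * form_eval p q N (harm_coeff p q n (N - n)) U V"
        by (simp add: T_def X_def r_def)
    qed
    also have "\<dots> = form_eval p q N (\<lambda>k. (1 - y) ^ k * y ^ (N - k)) U V"
      unfolding form_eval_sum[symmetric]
      by (rule form_eval_cong)
        (use monomial_harmonic_expansion[OF assms, of _ N y] in \<open>simp add: w_def r_def\<close>)
    also have "\<dots> = (\<Sum>k\<le>N. a k * b (N - k))"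
      unfolding form_eval_def a_def b_def by (simp add: power_mult_distrib ac_simps)
    finally show ?thesis .
  qed
  have "(\<lambda>N. \<Sum>k\<le>N. a k * b (N - k)) sums (suminf a * suminf b)"
    unfolding a_def b_def using C
    by (intro Cauchy_product_sums summable_norm_hyp0F1[where C = C]) auto
  then have "S = suminf a * suminf b"
    using S2 unfolding diag by (rule sums_unique2[symmetric])
  then show ?thesis
    using S1 unfolding inner w_def H_def a_def b_def hyp0F1_eq by simp
qed

text \<open>Dividing by the term \<open>k = 0\<close> leaves a polynomial in \<open>U / V\<close>.
  Reflecting the Pochhammer symbol with base \<open>1 - n - q\<close> identifies it as a terminating
  2F1, the shape used in \<open>f_even\<close> and \<open>f_odd\<close>.\<close>

lemma form_eval_alternating_eq_hyp_poly:
  fixes U V :: "'a::{real_normed_field, banach}"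
  assumes "p > 0" "q > 0" "V \<noteq> 0"
  shows "form_eval p q n (\<lambda>k. (-1) ^ (n + k)) U V
     = (- V) ^ n / of_real (fact n * pochhammer q n) * hyp_poly n (1 - real n - q) p (- (U / V))"
  unfolding form_eval_def hyp_poly_def sum_distrib_left
proof (rule sum.cong[OF refl])
  fix k assume k: "k \<in> {..n}"
  have pos: "pochhammer p k > 0" "pochhammer q (n - k) > 0" "pochhammer (q + real (n - k)) k > 0"
    using assms by (auto intro: pochhammer_pos add_pos_nonneg)
  have 1: "pochhammer (1 - real n - q) k = (-1) ^ k * pochhammer (q + real (n - k)) k"
    using k pochhammer_minus[of "real n + q - 1" k] by (simp add: algebra_simps of_nat_diff)
  have 2: "pochhammer q n = pochhammer q (n - k) * pochhammer (q + real (n - k)) k"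
    using k pochhammer_product[of "n - k" n q] by simp
  define c where "c = (-1) ^ k * real (n choose k) * pochhammer (1 - real n - q) k / pochhammer p k"
  have c: "c = fact n / (fact k * fact (n - k)) * pochhammer (q + real (n - k)) k / pochhammer p k"
    using k by (simp add: c_def 1 binomial_fact power_add[symmetric] mult.assoc[symmetric])
  have "1 / (fact n * pochhammer q n) * c
      = 1 / (fact k * pochhammer p k * fact (n - k) * pochhammer q (n - k))"
    unfolding c 2 using pos by simp
  then have "of_real (1 / (fact n * pochhammer q n) * c)
      = (of_real (1 / (fact k * pochhammer p k * fact (n - k) * pochhammer q (n - k))) :: 'a)"
    by (rule arg_cong)
  then have 3: "of_real c / of_real (fact n * pochhammer q n)
      = 1 / (of_real (fact k * pochhammer p k) * of_real (fact (n - k) * pochhammer q (n - k)) :: 'a)"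
    by (simp add: ac_simps)
  have "V ^ n / V ^ k = V ^ (n - k)"
    using k assms by (simp add: power_diff)
  then have 4: "(- V) ^ n * (- (U / V)) ^ k = (-1) ^ (n + k) * (U ^ k * V ^ (n - k))"
    unfolding power_minus[of V] power_minus[of "U / V"] power_divide power_add by (simp flip: \<open>V ^ n / V ^ k = V ^ (n - k)\<close>)
  have "(- V) ^ n / of_real (fact n * pochhammer q n) * (of_real c * (- (U / V)) ^ k)
      = (of_real c / of_real (fact n * pochhammer q n)) * ((- V) ^ n * (- (U / V)) ^ k)"
    by simp
  also have "\<dots> = of_real ((-1) ^ (n + k)) * (U ^ k / of_real (fact k * pochhammer p k))
      * (V ^ (n - k) / of_real (fact (n - k) * pochhammer q (n - k)))"
    unfolding 3 4 by simp
  finally show "of_real ((-1) ^ (n + k)) * (U ^ k / of_real (fact k * pochhammer p k))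
      * (V ^ (n - k) / of_real (fact (n - k) * pochhammer q (n - k)))
      = (- V) ^ n / of_real (fact n * pochhammer q n)
        * (of_real ((-1) ^ k * real (n choose k) * pochhammer (1 - real n - q) k / pochhammer p k)
           * (- (U / V)) ^ k)"
    unfolding c_def ..
qed

lemma bateman_expansion:
  fixes U V :: "'a::{real_normed_field, banach}" and p q y :: real
  assumes "p > 0" "q > 0" "V \<noteq> 0"
  shows "(\<lambda>n. (- V) ^ n / of_real (fact n * pochhammer (real n + p + q - 1) n)
          * hyp_poly n (1 - real n - q) p (- (U / V)) * of_real (hyp_poly n (real n + p + q - 1) q y)
          * hyp0F1 (p + q + 2 * real n) (U + V))
     sums (hyp0F1 p (U * of_real (1 - y)) * hyp0F1 q (V * of_real y))"
proof -
  have "pochhammer q n > 0" for n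
    using assms by (intro pochhammer_pos)
  then have "of_real (pochhammer q n / pochhammer (real n + p + q - 1) n * hyp_poly n (real n + p + q - 1) q y)
      * form_eval p q n (\<lambda>k. (-1) ^ (n + k)) U V
      = (- V) ^ n / of_real (fact n * pochhammer (real n + p + q - 1) n)
          * hyp_poly n (1 - real n - q) p (- (U / V)) * of_real (hyp_poly n (real n + p + q - 1) q y)" for n
    unfolding form_eval_alternating_eq_hyp_poly[OF assms]
    by (simp add: less_imp_neq[symmetric] ac_simps)
  then show ?thesis
    using bateman_expansion_form_eval[OF assms(1,2), of y U V] by simp
qed

section \<open>Convergence\<close>

text \<open>This class is closed under sums and products and becomes summable after division by
  \<open>n!\<close>, so convergence can be checked ingredient by ingredient.\<close>

definition geom_bounded :: "(nat \<Rightarrow> 'a::real_normed_field) \<Rightarrow> bool" where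
  "geom_bounded f \<longleftrightarrow> (\<exists>A B. A \<ge> 0 \<and> B \<ge> 1 \<and> (\<forall>n. norm (f n) \<le> A * B ^ n))"

named_theorems geom_bounded_intros

lemma geom_boundedI:
  assumes "\<And>n. norm (f n) \<le> A * B ^ n"
  shows "geom_bounded f"
  unfolding geom_bounded_def
proof (rule exI[of _ "\<bar>A\<bar>"], rule exI[of _ "max 1 \<bar>B\<bar>"], intro conjI allI)
  fix n
  have "A * B ^ n \<le> \<bar>A\<bar> * \<bar>B\<bar> ^ n"
    by (metis abs_ge_self abs_mult power_abs)
  also have "\<dots> \<le> \<bar>A\<bar> * max 1 \<bar>B\<bar> ^ n"
    by (intro mult_left_mono power_mono) auto
  finally show "norm (f n) \<le> \<bar>A\<bar> * max 1 \<bar>B\<bar> ^ n"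
    using assms[of n] by linarith
qed auto

lemma geom_bounded_const [geom_bounded_intros]: "geom_bounded (\<lambda>n. c)"
  by (rule geom_boundedI[of _ "norm c" 1]) simp

lemma geom_bounded_power [geom_bounded_intros]: "geom_bounded (\<lambda>n. c ^ n)"
  by (rule geom_boundedI[of _ 1 "norm c"]) (simp add: norm_power)

lemma geom_bounded_of_nat [geom_bounded_intros]: "geom_bounded (\<lambda>n. of_nat n)"
  by (rule geom_boundedI[of _ 1 2]) (simp add: less_imp_le[OF of_nat_less_two_power])

lemma geom_bounded_mult [geom_bounded_intros]:
  assumes "geom_bounded f" "geom_bounded g"
  shows "geom_bounded (\<lambda>n. f n * g n)"
proof -
  obtain A B where f: "A \<ge> 0" "B \<ge> 1" "\<And>n. norm (f n) \<le> A * B ^ n"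
    using assms(1) unfolding geom_bounded_def by blast
  obtain A' B' where g: "A' \<ge> 0" "B' \<ge> 1" "\<And>n. norm (g n) \<le> A' * B' ^ n"
    using assms(2) unfolding geom_bounded_def by blast
  have "norm (f n * g n) \<le> (A * B ^ n) * (A' * B' ^ n)" for n
    unfolding norm_mult using f g by (intro mult_mono) auto
  then show ?thesis
    by (intro geom_boundedI[of _ "A * A'" "B * B'"]) (simp add: power_mult_distrib ac_simps)
qed

lemma geom_bounded_add [geom_bounded_intros]:
  assumes "geom_bounded f" "geom_bounded g"
  shows "geom_bounded (\<lambda>n. f n + g n)"
proof -
  obtain A B where f: "A \<ge> 0" "B \<ge> 1" "\<And>n. norm (f n) \<le> A * B ^ n"
    using assms(1) unfolding geom_bounded_def by blast
  obtain A' B' where g: "A' \<ge> 0" "B' \<ge> 1" "\<And>n. norm (g n) \<le> A' * B' ^ n"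
    using assms(2) unfolding geom_bounded_def by blast
  have "norm (f n + g n) \<le> (A + A') * (max B B') ^ n" for n
  proof -
    have "norm (f n + g n) \<le> A * B ^ n + A' * B' ^ n"
      by (intro norm_triangle_mono f g)
    also have "\<dots> \<le> A * max B B' ^ n + A' * max B B' ^ n"
      using f g by (intro add_mono mult_left_mono power_mono) auto
    finally show ?thesis
      by (simp add: algebra_simps)
  qed
  then show ?thesis
    by (rule geom_boundedI)
qed

lemma geom_bounded_minus [geom_bounded_intros]:
  "geom_bounded f \<Longrightarrow> geom_bounded (\<lambda>n. - f n)"
  by (simp add: geom_bounded_def)

lemma geom_bounded_diff [geom_bounded_intros]:
  "geom_bounded f \<Longrightarrow> geom_bounded g \<Longrightarrow> geom_bounded (\<lambda>n. f n - g n)"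
  using geom_bounded_add[OF _ geom_bounded_minus[of g]] by auto

lemma geom_bounded_of_real [geom_bounded_intros]:
  "geom_bounded f \<Longrightarrow> geom_bounded (\<lambda>n. of_real (f n))"
  by (simp add: geom_bounded_def)

lemma geom_bounded_divide_ge_1 [geom_bounded_intros]:
  assumes "geom_bounded f" "\<And>n. norm (g n) \<ge> 1"
  shows "geom_bounded (\<lambda>n. f n / g n)"
proof -
  obtain A B where f: "A \<ge> 0" "B \<ge> 1" "\<And>n. norm (f n) \<le> A * B ^ n"
    using assms(1) unfolding geom_bounded_def by blast
  have "norm (f n / g n) \<le> A * B ^ n" for n
    using f(3)[of n] assms(2)[of n] by (simp add: norm_divide divide_le_eq mult_le_cancel_left1 order_trans)
      (smt (verit) mult_left_le mult_le_cancel_left1 norm_ge_zero)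
  then show ?thesis
    by (rule geom_boundedI)
qed

lemma summable_geom_bounded_div_fact:
  fixes f :: "nat \<Rightarrow> 'a::{real_normed_field, banach}"
  assumes "geom_bounded f"
  shows "summable (\<lambda>n. f n / fact n)"
proof -
  obtain A B where f: "\<And>n. norm (f n) \<le> A * B ^ n"
    using assms unfolding geom_bounded_def by blast
  then have "norm (f n / fact n) \<le> A * (B ^ n / fact n)" for n
    by (simp add: norm_divide divide_right_mono)
  then show ?thesis
    by (intro summable_comparison_test'[OF summable_mult[OF summable_power_div_fact[of B], of A], of 0]) auto
qed

text \<open>The numerator satisfies \<open>\<bar>pochhammer a k\<bar> \<le> pochhammer (N + 1) k =
  k! (N + k choose k)\<close>. The factorial is absorbed by \<open>C ^ k * pochhammer b k\<close>
  and the binomial by a power of 2, so a parameter \<open>a\<close> growing linearly costs only a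
  geometric factor.\<close>

lemma norm_hyp_poly_le:
  fixes z :: "'a::real_normed_field"
  assumes "C \<ge> 1" "C * b \<ge> 1" "\<bar>a\<bar> \<le> real N"
  shows "norm (hyp_poly m a b z) \<le> 2 ^ N * (1 + 2 * C * norm z) ^ m"
proof -
  have b: "b > 0"
    using assms by (smt (verit) mult_nonneg_nonpos)
  have coeff: "\<bar>pochhammer a k / pochhammer b k\<bar> \<le> C ^ k * 2 ^ (N + k)" for k
  proof -
    have pos: "pochhammer b k > 0"
      using b by (rule pochhammer_pos)
    have "\<bar>pochhammer a k\<bar> \<le> pochhammer \<bar>a\<bar> k"
      unfolding pochhammer_prod abs_prod by (intro prod_mono) auto
    also have "\<dots> \<le> pochhammer (real N + 1) k"
      using assms by (intro pochhammer_mono_base) auto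
    also have "\<dots> = fact k * real (N + k choose k)"
      unfolding binomial_gbinomial gbinomial_pochhammer' by (simp add: algebra_simps)
    also have "\<dots> \<le> (C ^ k * pochhammer b k) * 2 ^ (N + k)"
    proof (intro mult_mono fact_le_power_pochhammer assms)
      have "real (N + k choose k) \<le> real (2 ^ (N + k))"
        by (rule of_nat_mono[OF binomial_le_pow2])
      then show "real (N + k choose k) \<le> 2 ^ (N + k)"
        by simp
    qed (use assms pos in auto)
    finally show ?thesis
      using pos by (simp add: abs_divide divide_le_eq ac_simps)
  qed
  have "norm (hyp_poly m a b z) \<le> (\<Sum>k\<le>m. 2 ^ N * (real (m choose k) * (2 * C * norm z) ^ k))"
    unfolding hyp_poly_def
  proof (rule sum_norm_le)
    fix k
    have "norm (of_real ((-1) ^ k * real (m choose k) * pochhammer a k / pochhammer b k) * z ^ k)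
        = real (m choose k) * norm z ^ k * \<bar>pochhammer a k / pochhammer b k\<bar>"
      by (simp add: norm_mult norm_divide norm_power abs_mult)
    also have "\<dots> \<le> real (m choose k) * norm z ^ k * (C ^ k * 2 ^ (N + k))"
      by (intro mult_left_mono coeff) auto
    finally show "norm (of_real ((-1) ^ k * real (m choose k) * pochhammer a k / pochhammer b k) * z ^ k)
        \<le> 2 ^ N * (real (m choose k) * (2 * C * norm z) ^ k)"
      by (simp add: power_mult_distrib power_add ac_simps)
  qed
  also have "\<dots> = 2 ^ N * (2 * C * norm z + 1) ^ m"
    by (subst binomial_ring) (simp add: sum_distrib_left)
  finally show ?thesis
    by (simp add: add.commute)
qed

text \<open>The degree may exceed the index by one because \<open>f_odd\<close> at index
  \<open>2n + 1\<close> contains a polynomial of degree \<open>n + 1\<close>.\<close>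

lemma geom_bounded_hyp_poly [geom_bounded_intros]:
  fixes z :: "'a::real_normed_field"
  assumes "b > 0" "\<And>n. m n \<le> Suc n" "\<And>n. \<bar>a n\<bar> \<le> real n + r"
  shows "geom_bounded (\<lambda>n. hyp_poly (m n) (a n) b z)"
proof -
  define C where "C = max 1 (1 / b)"
  have C: "C \<ge> 1" "C * b \<ge> 1"
    using assms(1) mult_right_mono[of "1 / b" C b] by (auto simp: C_def)
  define R where "R = nat \<lceil>r\<rceil>"
  have "norm (hyp_poly (m n) (a n) b z) \<le> (2 ^ R * (1 + 2 * C * norm z)) * (2 * (1 + 2 * C * norm z)) ^ n" for n
  proof -
    have "\<bar>a n\<bar> \<le> real (n + R)"
      using assms(3)[of n] unfolding R_def by linarith
    then have "norm (hyp_poly (m n) (a n) b z) \<le> 2 ^ (n + R) * (1 + 2 * C * norm z) ^ m n"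
      by (intro norm_hyp_poly_le C)
    also have "\<dots> \<le> 2 ^ (n + R) * (1 + 2 * C * norm z) ^ Suc n"
      using C assms(2)[of n] by (intro mult_left_mono power_increasing) auto
    finally show ?thesis
      unfolding power_add power_mult_distrib power_Suc by (simp only: ac_simps)
  qed
  then show ?thesis
    by (rule geom_boundedI)
qed

lemma geom_bounded_hyp0F1 [geom_bounded_intros]:
  fixes z :: "'a::{real_normed_field, banach}"
  assumes "\<And>n. b n \<ge> 1"
  shows "geom_bounded (\<lambda>n. hyp0F1 (b n) z)"
  using norm_hyp0F1_le[of 1 "b _" z] assms by (intro geom_boundedI[of _ "exp (norm z)" 1]) simp

section \<open>Coefficients of the expansion\<close>

lemma mu_fact_Suc: "mu_fact \<mu> (Suc n) = mu_fact \<mu> n * mu_number \<mu> (Suc n)"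
  by (simp add: mu_fact_def)

lemma mu_fact_even: "mu_fact \<mu> (2 * n) = 4 ^ n * fact n * pochhammer (\<mu> + 1/2) n"
proof (induction n)
  case (Suc n)
  have "mu_fact \<mu> (2 * Suc n) = mu_fact \<mu> (2 * n) * mu_number \<mu> (Suc (2 * n)) * mu_number \<mu> (Suc (Suc (2 * n)))"
    by (simp add: mu_fact_Suc)
  then show ?case
    unfolding Suc.IH by (simp add: mu_number_def pochhammer_Suc algebra_simps)
qed (simp add: mu_fact_def)

lemma mu_fact_odd: "mu_fact \<mu> (2 * n + 1) = 2 * 4 ^ n * fact n * pochhammer (\<mu> + 1/2) (Suc n)"
proof -
  have "mu_fact \<mu> (2 * n + 1) = mu_fact \<mu> (2 * n) * mu_number \<mu> (Suc (2 * n))"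
    by (simp add: mu_fact_Suc)
  then show ?thesis
    unfolding mu_fact_even by (simp add: mu_number_def pochhammer_Suc algebra_simps)
qed

lemma Gamma_plus_nat:
  fixes x :: real
  assumes "x > 0"
  shows "Gamma (x + real n) = pochhammer x n * Gamma x"
proof -
  have "x \<notin> \<int>\<^sub>\<le>\<^sub>0"
    using assms by (auto elim: nonpos_Ints_cases)
  then show ?thesis
    using pochhammer_Gamma[of x n] less_imp_neq[OF Gamma_real_pos[OF assms]] by simp
qed

text \<open>The Gamma factors are brought to those in the numerator of \<open>K_coeff\<close>, where
  they cancel.\<close>

lemma jacobi_norm_even:
  assumes "\<alpha> > 0" "\<beta> > 0"
  shows "jacobi_norm (2 * n) (2 * \<beta>) (2 * \<alpha>)
       = Gamma (\<alpha> + 1/2) * Gamma (\<beta> + 1/2) * pochhammer (\<alpha> + 1/2) n * fact n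
         / (Gamma (\<alpha> + \<beta> + 1 + real n) * pochhammer (\<beta> + 1/2) n)"
proof -
  have 1: "(real (2 * n) + 2 * \<alpha> + 1) / 2 = \<alpha> + 1/2 + real n"
    "(real (2 * n) + 2 * \<beta> + 3) / 2 = \<beta> + 1/2 + real (Suc n)"
    "(real (2 * n) + 2 * \<beta> + 2 * \<alpha> + 2) / 2 = \<alpha> + \<beta> + 1 + real n"
    "(2 * \<beta> + 1) / 2 = \<beta> + 1/2"
    "real (2 * n) + 2 * \<beta> + 1 = 2 * (\<beta> + 1/2 + real n)"
    by (simp_all add: field_simps)
  have pos: "pochhammer (\<beta> + 1/2) n > 0" "Gamma (\<alpha> + \<beta> + 1 + real n) > 0" "\<beta> + 1/2 + real n > 0"
    using assms by (auto intro!: pochhammer_pos Gamma_real_pos add_pos_nonneg)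
  have 2: "Gamma (\<alpha> + 1/2 + real n) = pochhammer (\<alpha> + 1/2) n * Gamma (\<alpha> + 1/2)"
    "Gamma (\<beta> + 1/2 + real (Suc n)) = pochhammer (\<beta> + 1/2) n * (\<beta> + 1/2 + real n) * Gamma (\<beta> + 1/2)"
    using Gamma_plus_nat[of "\<alpha> + 1/2" n] Gamma_plus_nat[of "\<beta> + 1/2" "Suc n"] assms
    by (simp_all only: pochhammer_Suc add_pos_pos half_gt_zero_iff zero_less_one)
  have "jacobi_norm (2 * n) (2 * \<beta>) (2 * \<alpha>)
      = 2 * (pochhammer (\<alpha> + 1/2) n * Gamma (\<alpha> + 1/2))
         * (pochhammer (\<beta> + 1/2) n * (\<beta> + 1/2 + real n) * Gamma (\<beta> + 1/2)) * fact n
       / (2 * (\<beta> + 1/2 + real n) * Gamma (\<alpha> + \<beta> + 1 + real n) * (pochhammer (\<beta> + 1/2) n)\<^sup>2)"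
    unfolding jacobi_norm_def Let_def 1 2 by simp
  also have "\<dots> = Gamma (\<alpha> + 1/2) * Gamma (\<beta> + 1/2) * pochhammer (\<alpha> + 1/2) n * fact n
         / (Gamma (\<alpha> + \<beta> + 1 + real n) * pochhammer (\<beta> + 1/2) n)"
    using pos by (simp add: divide_simps power2_eq_square)
  finally show ?thesis .
qed

lemma jacobi_norm_odd:
  assumes "\<alpha> > 0" "\<beta> > 0"
  shows "jacobi_norm (2 * n + 1) (2 * \<beta>) (2 * \<alpha>)
       = Gamma (\<alpha> + 1/2) * Gamma (\<beta> + 1/2) * pochhammer (\<alpha> + 1/2) (Suc n) * fact n
         / (Gamma (\<alpha> + \<beta> + 1 + real n) * pochhammer (\<beta> + 1/2) (Suc n))"
proof -
  have 1: "(real (2 * n + 1) + 2 * \<alpha> + 2) / 2 = \<alpha> + 1/2 + real (Suc n)"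
    "(real (2 * n + 1) + 2 * \<beta> + 2) / 2 = \<beta> + 1/2 + real (Suc n)"
    "(real (2 * n + 1) + 2 * \<beta> + 2 * \<alpha> + 3) / 2 = \<alpha> + \<beta> + 1 + real n + real 1"
    "(2 * \<beta> + 1) / 2 = \<beta> + 1/2"
    "real (2 * n + 1) + 2 * \<beta> + 2 * \<alpha> + 1 = 2 * (\<alpha> + \<beta> + 1 + real n)"
    "(2 * n + 1 + 1) div 2 = Suc n" "(2 * n + 1 - 1) div 2 = n"
    by (simp_all add: field_simps)
  have pos: "pochhammer (\<beta> + 1/2) (Suc n) > 0" "Gamma (\<alpha> + \<beta> + 1 + real n) > 0" "\<alpha> + \<beta> + 1 + real n > 0"
    using assms by (auto intro!: pochhammer_pos Gamma_real_pos add_pos_nonneg)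
  have 2: "Gamma (\<alpha> + 1/2 + real (Suc n)) = pochhammer (\<alpha> + 1/2) (Suc n) * Gamma (\<alpha> + 1/2)"
    "Gamma (\<beta> + 1/2 + real (Suc n)) = pochhammer (\<beta> + 1/2) (Suc n) * Gamma (\<beta> + 1/2)"
    "Gamma (\<alpha> + \<beta> + 1 + real n + real 1) = (\<alpha> + \<beta> + 1 + real n) * Gamma (\<alpha> + \<beta> + 1 + real n)"
    using Gamma_plus_nat[of "\<alpha> + 1/2" "Suc n"] Gamma_plus_nat[of "\<beta> + 1/2" "Suc n"]
      Gamma_plus_nat[of "\<alpha> + \<beta> + 1 + real n" 1] assms
    by (simp_all add: add_pos_nonneg)
  have "jacobi_norm (2 * n + 1) (2 * \<beta>) (2 * \<alpha>)
      = 2 * (\<alpha> + \<beta> + 1 + real n) * (pochhammer (\<alpha> + 1/2) (Suc n) * Gamma (\<alpha> + 1/2))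
         * (pochhammer (\<beta> + 1/2) (Suc n) * Gamma (\<beta> + 1/2)) * fact n
       / (2 * ((\<alpha> + \<beta> + 1 + real n) * Gamma (\<alpha> + \<beta> + 1 + real n)) * (pochhammer (\<beta> + 1/2) (Suc n))\<^sup>2)"
    unfolding jacobi_norm_def Let_def 1 2 by (simp add: ac_simps)
  also have "\<dots> = Gamma (\<alpha> + 1/2) * Gamma (\<beta> + 1/2) * pochhammer (\<alpha> + 1/2) (Suc n) * fact n
         / (Gamma (\<alpha> + \<beta> + 1 + real n) * pochhammer (\<beta> + 1/2) (Suc n))"
    using pos by (simp add: divide_simps power2_eq_square)
  finally show ?thesis .
qed

lemma half_power_even: "(x / 2) ^ (2 * n) = 4 ^ n * ((x / 4) ^ n)\<^sup>2" for x :: real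
proof -
  have "(x / 2)\<^sup>2 = 4 * (x / 4)\<^sup>2"
    by (simp add: power2_eq_square)
  then have "(x / 2) ^ (2 * n) = 4 ^ n * ((x / 4)\<^sup>2) ^ n"
    by (simp only: power_mult power_mult_distrib)
  then show ?thesis
    by (simp only: power_mult[symmetric] mult.commute[of n 2])
qed

lemma sqrt_mult_divide: "s * sqrt a / sqrt b * sqrt d = s * sqrt (a / b * d)"
  by (simp add: real_sqrt_mult real_sqrt_divide)

text \<open>The three square roots merge into one, whose radicand is a perfect square. For even
  index the sign factor and the quotient containing \<sigma> are both 1.\<close>

lemma K_coeff_prefactor_even:
  assumes "\<mu>1 > 0" "\<mu>2 > 0" "\<sigma> \<in> {1, -1}" "\<bar>lam\<bar> > \<bar>c\<bar>"
  shows "K_coeff (2 * n) \<sigma> lam \<mu>2 \<mu>1 c / sqrt (mu_fact \<mu>2 (2 * n))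
      * sqrt (pochhammer (1/2 + \<mu>1) n / pochhammer (real n + 1 + \<mu>1 + \<mu>2) n)
     = ((lam\<^sup>2 - c\<^sup>2) / 4) ^ n / (fact n * pochhammer (real n + 1 + \<mu>1 + \<mu>2) n)"
proof -
  define L where "L = lam\<^sup>2 - c\<^sup>2"
  define Q where "Q = pochhammer (real n + 1 + \<mu>1 + \<mu>2) n"
  define r where "r = (L / 4) ^ n / (fact n * Q)"
  have L: "L > 0"
    using abs_le_square_iff[of lam c] assms(4) unfolding L_def by linarith
  have Q: "Q > 0"
    unfolding Q_def using assms by (intro pochhammer_pos) auto
  have r: "r \<ge> 0"
    using L Q by (simp add: r_def)
  have lam: "lam \<noteq> 0" "lam - c * \<sigma> \<noteq> 0"
    using assms by auto
  have G: "Gamma (\<mu>1 + 1/2) > 0" "Gamma (\<mu>2 + 1/2) > 0" "Gamma (\<mu>1 + \<mu>2 + 1 + real n) > 0"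
    using assms by (auto intro!: Gamma_real_pos add_pos_nonneg)
  have P: "pochhammer (\<mu>1 + 1/2) n > 0" "pochhammer (\<mu>2 + 1/2) n > 0"
    using assms by (auto intro!: pochhammer_pos)
  have G2: "Gamma (\<mu>1 + \<mu>2 + real (2 * n) + 1) = Q * Gamma (\<mu>1 + \<mu>2 + 1 + real n)"
    using Gamma_plus_nat[of "\<mu>1 + \<mu>2 + 1 + real n" n] assms by (simp add: Q_def algebra_simps)
  have pow: "(L / 2) ^ (2 * n) = 4 ^ n * ((L / 4) ^ n)\<^sup>2"
    by (rule half_power_even)
  have "K_coeff (2 * n) \<sigma> lam \<mu>2 \<mu>1 c = sqrt ((L / 2) ^ (2 * n) * 1 * (Gamma (\<mu>1 + 1/2) * Gamma (\<mu>2 + 1/2))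
      / (Q * Gamma (\<mu>1 + \<mu>2 + 1 + real n) * (Gamma (\<mu>1 + 1/2) * Gamma (\<mu>2 + 1/2) * pochhammer (\<mu>1 + 1/2) n * fact n
         / (Gamma (\<mu>1 + \<mu>2 + 1 + real n) * pochhammer (\<mu>2 + 1/2) n))))"
    unfolding K_coeff_def L_def[symmetric] G2 jacobi_norm_even[OF assms(1,2)]
    using lam by (simp add: power_mult sgn_if)
  then have "K_coeff (2 * n) \<sigma> lam \<mu>2 \<mu>1 c / sqrt (mu_fact \<mu>2 (2 * n)) * sqrt (pochhammer (1/2 + \<mu>1) n / Q)
     = sqrt ((L / 2) ^ (2 * n) * 1 * (Gamma (\<mu>1 + 1/2) * Gamma (\<mu>2 + 1/2))
      / (Q * Gamma (\<mu>1 + \<mu>2 + 1 + real n) * (Gamma (\<mu>1 + 1/2) * Gamma (\<mu>2 + 1/2) * pochhammer (\<mu>1 + 1/2) n * fact n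
         / (Gamma (\<mu>1 + \<mu>2 + 1 + real n) * pochhammer (\<mu>2 + 1/2) n)))
      / (4 ^ n * fact n * pochhammer (\<mu>2 + 1/2) n) * (pochhammer (\<mu>1 + 1/2) n / Q))"
    unfolding mu_fact_even using sqrt_mult_divide[of 1] by (simp only: mult_1 add.commute[of "1/2" \<mu>1])
  also have "\<dots> = sqrt (r\<^sup>2)"
    unfolding pow r_def using G P Q
    by (intro arg_cong[where f = sqrt]) (simp add: divide_simps power2_eq_square)
  also have "\<dots> = r"
    using r by simp
  finally show ?thesis
    by (simp add: r_def Q_def L_def)
qed

lemma K_coeff_prefactor_odd:
  assumes "\<mu>1 > 0" "\<mu>2 > 0" "\<sigma> \<in> {1, -1}" "\<bar>lam\<bar> > \<bar>c\<bar>"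
  shows "K_coeff (2 * n + 1) \<sigma> lam \<mu>2 \<mu>1 c / sqrt (mu_fact \<mu>2 (2 * n + 1))
      * sqrt (pochhammer (1/2 + \<mu>1) (Suc n) / pochhammer (real n + 1 + \<mu>1 + \<mu>2) (Suc n))
     = ((lam\<^sup>2 - c\<^sup>2) / 4) ^ n * (lam - c * \<sigma>) / 2
        / (fact n * pochhammer (real n + 1 + \<mu>1 + \<mu>2) (Suc n))"
proof -
  define L where "L = lam\<^sup>2 - c\<^sup>2"
  define Q where "Q = pochhammer (real n + 1 + \<mu>1 + \<mu>2) (Suc n)"
  define d where "d = lam - c * \<sigma>"
  define r where "r = (L / 4) ^ n * \<bar>d\<bar> / 2 / (fact n * Q)"
  have L: "L > 0"
    using abs_le_square_iff[of lam c] assms(4) unfolding L_def by linarith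
  have Q: "Q > 0"
    unfolding Q_def using assms by (intro pochhammer_pos) auto
  have r: "r \<ge> 0"
    using L Q by (simp add: r_def)
  \<comment> \<open>The root only yields \<open>\<bar>d\<bar>\<close>. Since
    \<open>\<bar>lam\<bar> > \<bar>c\<bar>\<close>, \<open>d\<close> has the sign of
    \<open>lam\<close>, and the sign factor in \<open>K_coeff\<close> restores it.\<close>
  have sd: "sgn lam * \<bar>d\<bar> = d"
    using assms by (auto simp: d_def sgn_if abs_if split: if_splits)
  have lam: "lam + c * \<sigma> \<noteq> 0"
    using assms by auto
  \<comment> \<open>As \<sigma> has square 1, \<open>L\<close> factors as
    \<open>d * (lam + c * \<sigma>)\<close>; this completes the square under the root.\<close>
  have Ld: "L * (d / (lam + c * \<sigma>)) = d\<^sup>2"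
    using assms lam by (auto simp: L_def d_def field_simps power2_eq_square)
  have G: "Gamma (\<mu>1 + 1/2) > 0" "Gamma (\<mu>2 + 1/2) > 0" "Gamma (\<mu>1 + \<mu>2 + 1 + real n) > 0"
    using assms by (auto intro!: Gamma_real_pos add_pos_nonneg)
  have P: "pochhammer (\<mu>1 + 1/2) (Suc n) > 0" "pochhammer (\<mu>2 + 1/2) (Suc n) > 0"
    using assms by (auto intro!: pochhammer_pos)
  have G2: "Gamma (\<mu>1 + \<mu>2 + real (2 * n + 1) + 1) = Q * Gamma (\<mu>1 + \<mu>2 + 1 + real n)"
    using Gamma_plus_nat[of "\<mu>1 + \<mu>2 + 1 + real n" "Suc n"] assms by (simp add: Q_def algebra_simps)
  have "(L / 2) ^ (2 * n) = 4 ^ n * ((L / 4) ^ n)\<^sup>2"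
    by (rule half_power_even)
  then have pow: "(L / 2) ^ (2 * n + 1) * (d / (lam + c * \<sigma>)) = 4 ^ n * ((L / 4) ^ n)\<^sup>2 * d\<^sup>2 / 2"
    unfolding Ld[symmetric] by (simp add: algebra_simps)
  have "K_coeff (2 * n + 1) \<sigma> lam \<mu>2 \<mu>1 c = sgn lam * sqrt ((L / 2) ^ (2 * n + 1) * (d / (lam + c * \<sigma>))
      * (Gamma (\<mu>1 + 1/2) * Gamma (\<mu>2 + 1/2))
      / (Q * Gamma (\<mu>1 + \<mu>2 + 1 + real n) * (Gamma (\<mu>1 + 1/2) * Gamma (\<mu>2 + 1/2) * pochhammer (\<mu>1 + 1/2) (Suc n) * fact n
         / (Gamma (\<mu>1 + \<mu>2 + 1 + real n) * pochhammer (\<mu>2 + 1/2) (Suc n)))))"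
    unfolding K_coeff_def L_def[symmetric] G2 jacobi_norm_odd[OF assms(1,2)] d_def[symmetric]
    by (simp add: power_mult sgn_if)
  then have "K_coeff (2 * n + 1) \<sigma> lam \<mu>2 \<mu>1 c / sqrt (mu_fact \<mu>2 (2 * n + 1)) * sqrt (pochhammer (1/2 + \<mu>1) (Suc n) / Q)
     = sgn lam * sqrt ((L / 2) ^ (2 * n + 1) * (d / (lam + c * \<sigma>)) * (Gamma (\<mu>1 + 1/2) * Gamma (\<mu>2 + 1/2))
      / (Q * Gamma (\<mu>1 + \<mu>2 + 1 + real n) * (Gamma (\<mu>1 + 1/2) * Gamma (\<mu>2 + 1/2) * pochhammer (\<mu>1 + 1/2) (Suc n) * fact n
         / (Gamma (\<mu>1 + \<mu>2 + 1 + real n) * pochhammer (\<mu>2 + 1/2) (Suc n))))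
      / (2 * 4 ^ n * fact n * pochhammer (\<mu>2 + 1/2) (Suc n)) * (pochhammer (\<mu>1 + 1/2) (Suc n) / Q))"
    unfolding mu_fact_odd by (simp only: sqrt_mult_divide add.commute[of "1/2" \<mu>1])
  also have "\<dots> = sgn lam * sqrt (r\<^sup>2)"
    unfolding pow r_def using G P Q
    by (intro arg_cong[where f = "\<lambda>x. sgn lam * sqrt x"])
      (simp add: divide_simps power2_eq_square abs_mult_self_eq del: pochhammer_Suc)
  also have "\<dots> = sgn lam * r"
    using r by simp
  also have "\<dots> = (L / 4) ^ n * (sgn lam * \<bar>d\<bar>) / 2 / (fact n * Q)"
    by (simp add: r_def)
  finally show ?thesis
    unfolding sd unfolding Q_def L_def d_def .
qed

section \<open>Contiguous relations for the Big -1 Jacobi polynomials\<close>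

lemma big_m1_jacobi_even:
  "big_m1_jacobi (2 * n) x (2 * \<beta>) (2 * \<alpha>) c
     = hyp_poly n (real n + \<alpha> + \<beta> + 1) (\<beta> + 1/2) ((1 - x\<^sup>2) / (1 - c\<^sup>2))
       + real n * ((1 - x) / (1 + c)) / (\<beta> + 1/2)
         * hyp_poly (n - 1) (real n + \<alpha> + \<beta> + 1) (\<beta> + 1/2 + 1) ((1 - x\<^sup>2) / (1 - c\<^sup>2))"
proof -
  have 1: "(real (2 * n) + 2 * \<beta> + 2 * \<alpha> + 2) / 2 = real n + \<alpha> + \<beta> + 1"
    "(2 * \<beta> + 1) / 2 = \<beta> + 1/2" "(2 * \<beta> + 3) / 2 = \<beta> + 1/2 + 1"
    "real (2 * n) * (1 - x) / ((1 + c) * (2 * \<beta> + 1)) = real n * ((1 - x) / (1 + c)) / (\<beta> + 1/2)"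
    by (simp_all add: field_simps)
  have 3: "hyp2F1 (- real (2 * n) / 2) a b y = hyp_poly n a b y" for a b y :: real
    using hyp2F1_neg_nat[of n a b y] by simp
  \<comment> \<open>At \<open>n = 0\<close> this 2F1 does not terminate, but its factor in the
    polynomial is 0; hence the case distinction below.\<close>
  have 2: "hyp2F1 (1 - real n) a b y = hyp_poly (n - 1) a b y" if "n > 0" for a b y :: real
    using hyp2F1_neg_nat[of "n - 1" a b y] that by (simp add: of_nat_diff)
  show ?thesis
    unfolding big_m1_jacobi_def Let_def 1 3 by (cases "n = 0") (simp_all add: 2)
qed

lemma big_m1_jacobi_odd:
  "big_m1_jacobi (2 * n + 1) x (2 * \<beta>) (2 * \<alpha>) c
     = hyp_poly n (real n + \<alpha> + \<beta> + 1) (\<beta> + 1/2) ((1 - x\<^sup>2) / (1 - c\<^sup>2))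
       - (real n + \<alpha> + \<beta> + 1) * ((1 - x) / (1 + c)) / (\<beta> + 1/2)
         * hyp_poly n (real n + \<alpha> + \<beta> + 1 + 1) (\<beta> + 1/2 + 1) ((1 - x\<^sup>2) / (1 - c\<^sup>2))"
proof -
  have 1: "- (real (2 * n + 1) - 1) / 2 = - real n"
    "(real (2 * n + 1) + 2 * \<beta> + 2 * \<alpha> + 1) / 2 = real n + \<alpha> + \<beta> + 1"
    "(real (2 * n + 1) + 2 * \<beta> + 2 * \<alpha> + 3) / 2 = real n + \<alpha> + \<beta> + 1 + 1"
    "(2 * \<beta> + 1) / 2 = \<beta> + 1/2" "(2 * \<beta> + 3) / 2 = \<beta> + 1/2 + 1"
    by (simp_all add: field_simps)
  have 2: "odd (2 * n + 1)"
    by simp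
  have "real (2 * n + 1) + 2 * \<beta> + 2 * \<alpha> + 1 = 2 * (real n + \<alpha> + \<beta> + 1)"
    "2 * \<beta> + 1 = 2 * (\<beta> + 1/2)"
    by simp_all
  moreover have "2 * a * u / (b * (2 * d)) = a * (u / b) / d" for a b d u :: real
    by simp
  ultimately have 3: "(real (2 * n + 1) + 2 * \<beta> + 2 * \<alpha> + 1) * (1 - x) / ((1 + c) * (2 * \<beta> + 1))
      = (real n + \<alpha> + \<beta> + 1) * ((1 - x) / (1 + c)) / (\<beta> + 1/2)"
    by (simp only:)
  show ?thesis
    unfolding big_m1_jacobi_def Let_def using 2 by (simp only: 1 3 hyp2F1_neg_nat if_False)
qed

text \<open>The weights in the first combination cancel the terms with \<xi>, and
  \<open>hyp_poly_contiguous_plus\<close> merges the rest. In the second,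
  \<open>hyp_poly_contiguous_minus\<close> turns the difference of the leading terms into a multiple
  of the polynomial that already accompanies \<xi>.\<close>

lemma big_m1_jacobi_even_odd_pred:
  fixes \<alpha> \<beta> x c :: real
  assumes "\<alpha> > 0" "\<beta> > 0"
  defines "J \<equiv> \<lambda>n. big_m1_jacobi n x (2 * \<beta>) (2 * \<alpha>) c" and "y \<equiv> (1 - x\<^sup>2) / (1 - c\<^sup>2)"
  shows "(real n + 1 + \<alpha> + \<beta>) * J (2 * Suc n) + (real n + 1) * J (2 * n + 1)
      = (2 * real n + 2 + \<alpha> + \<beta>) * hyp_poly (Suc n) (real n + 1 + \<alpha> + \<beta>) (\<beta> + 1/2) y"
    and "J (2 * Suc n) - J (2 * n + 1)
      = (2 * real n + 2 + \<alpha> + \<beta>) * ((1 - x) / (1 + c) - y) / (\<beta> + 1/2)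
        * hyp_poly n (real n + 2 + \<alpha> + \<beta>) (\<beta> + 1/2 + 1) y"
proof -
  define q where "q = \<beta> + 1/2"
  define a where "a = real n + \<alpha> + \<beta> + 1"
  define \<xi> where "\<xi> = (1 - x) / (1 + c)"
  have q: "q > 0" and a: "a > 0"
    using assms by (auto simp: q_def a_def)
  have a': "real (Suc n) + \<alpha> + \<beta> + 1 = a + 1" "real n + 1 + \<alpha> + \<beta> = a" "real n + 2 + \<alpha> + \<beta> = a + 1"
    "2 * real n + 2 + \<alpha> + \<beta> = real (Suc n) + a"
    by (simp_all add: a_def)
  have J0: "J (2 * Suc n) = hyp_poly (Suc n) (a + 1) q y + real (Suc n) * \<xi> / q * hyp_poly n (a + 1) (q + 1) y"
    unfolding J_def big_m1_jacobi_even y_def[symmetric] a' q_def[symmetric] \<xi>_def[symmetric] by simp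
  have J1: "J (2 * n + 1) = hyp_poly n a q y - a * \<xi> / q * hyp_poly n (a + 1) (q + 1) y"
    unfolding J_def big_m1_jacobi_odd y_def[symmetric] a_def[symmetric] q_def[symmetric] \<xi>_def[symmetric] by simp
  have "a * J (2 * Suc n) + real (Suc n) * J (2 * n + 1)
      = a * hyp_poly (Suc n) (a + 1) q y + real (Suc n) * hyp_poly n a q y"
    unfolding J0 J1 by (simp add: algebra_simps)
  also have "\<dots> = (real (Suc n) + a) * hyp_poly (Suc n) a q y"
    using hyp_poly_contiguous_plus[of a "Suc n" q y] by simp
  finally show "(real n + 1 + \<alpha> + \<beta>) * J (2 * Suc n) + (real n + 1) * J (2 * n + 1)
      = (2 * real n + 2 + \<alpha> + \<beta>) * hyp_poly (Suc n) (real n + 1 + \<alpha> + \<beta>) (\<beta> + 1/2) y"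
    unfolding a' q_def[symmetric] by (simp add: add.commute)
  have "J (2 * Suc n) - J (2 * n + 1) = (hyp_poly (Suc n) (a + 1) q y - hyp_poly n a q y)
      + (real (Suc n) + a) * \<xi> / q * hyp_poly n (a + 1) (q + 1) y"
    unfolding J0 J1 by (simp add: divide_inverse algebra_simps)
  also have "\<dots> = (real (Suc n) + a) * (\<xi> - y) / q * hyp_poly n (a + 1) (q + 1) y"
    unfolding hyp_poly_contiguous_minus[OF a q] by (simp add: divide_inverse algebra_simps)
  finally show "J (2 * Suc n) - J (2 * n + 1)
      = (2 * real n + 2 + \<alpha> + \<beta>) * ((1 - x) / (1 + c) - y) / (\<beta> + 1/2)
        * hyp_poly n (real n + 2 + \<alpha> + \<beta>) (\<beta> + 1/2 + 1) y"
    unfolding a' q_def[symmetric] \<xi>_def[symmetric] .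
qed

text \<open>The difference cancels the leading terms and leaves
  \<open>hyp_poly_contiguous_plus\<close>. The second weights are \<open>a - q\<close> and
  \<open>n + q\<close>, those for which \<open>hyp_poly_contiguous_mixed\<close> makes the terms
  with \<xi> a multiple of the leading one.\<close>

lemma big_m1_jacobi_even_odd_succ:
  fixes \<alpha> \<beta> x c :: real
  assumes "\<alpha> > 0" "\<beta> > 0"
  defines "J \<equiv> \<lambda>n. big_m1_jacobi n x (2 * \<beta>) (2 * \<alpha>) c" and "y \<equiv> (1 - x\<^sup>2) / (1 - c\<^sup>2)"
  shows "J (2 * n) - J (2 * n + 1)
      = (2 * real n + 1 + \<alpha> + \<beta>) * ((1 - x) / (1 + c)) / (\<beta> + 1/2)
        * hyp_poly n (real n + 1 + \<alpha> + \<beta>) (\<beta> + 1/2 + 1) y"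
    and "(real n + (\<alpha> + 1/2)) * J (2 * n) + (real n + (\<beta> + 1/2)) * J (2 * n + 1)
      = (2 * real n + 1 + \<alpha> + \<beta>) * (1 - (1 - x) / (1 + c))
        * hyp_poly n (real n + 1 + \<alpha> + \<beta>) (\<beta> + 1/2) y"
proof -
  define q where "q = \<beta> + 1/2"
  define a where "a = real n + \<alpha> + \<beta> + 1"
  define \<xi> where "\<xi> = (1 - x) / (1 + c)"
  have q: "q > 0"
    using assms by (auto simp: q_def)
  have a': "real n + 1 + \<alpha> + \<beta> = a" "2 * real n + 1 + \<alpha> + \<beta> = real n + a" "real n + (\<alpha> + 1/2) = a - q"
    by (simp_all add: a_def q_def)
  have J0: "J (2 * n) = hyp_poly n a q y + real n * \<xi> / q * hyp_poly (n - 1) a (q + 1) y"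
    unfolding J_def big_m1_jacobi_even y_def[symmetric] a_def[symmetric] q_def[symmetric] \<xi>_def[symmetric] by simp
  have J1: "J (2 * n + 1) = hyp_poly n a q y - a * \<xi> / q * hyp_poly n (a + 1) (q + 1) y"
    unfolding J_def big_m1_jacobi_odd y_def[symmetric] a_def[symmetric] q_def[symmetric] \<xi>_def[symmetric] by simp
  have "J (2 * n) - J (2 * n + 1)
      = \<xi> / q * (a * hyp_poly n (a + 1) (q + 1) y + real n * hyp_poly (n - 1) a (q + 1) y)"
    unfolding J0 J1 by (simp add: divide_inverse algebra_simps)
  also have "\<dots> = (real n + a) * \<xi> / q * hyp_poly n a (q + 1) y"
    unfolding hyp_poly_contiguous_plus by simp
  finally show "J (2 * n) - J (2 * n + 1)
      = (2 * real n + 1 + \<alpha> + \<beta>) * ((1 - x) / (1 + c)) / (\<beta> + 1/2)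
        * hyp_poly n (real n + 1 + \<alpha> + \<beta>) (\<beta> + 1/2 + 1) y"
    unfolding a' q_def[symmetric] \<xi>_def[symmetric] .
  have "(a - q) * J (2 * n) + (real n + q) * J (2 * n + 1) = (real n + a) * hyp_poly n a q y
      + \<xi> / q * ((a - q) * (real n * hyp_poly (n - 1) a (q + 1) y) - (real n + q) * (a * hyp_poly n (a + 1) (q + 1) y))"
    unfolding J0 J1 by (simp add: divide_inverse algebra_simps)
  also have "\<dots> = (real n + a) * (1 - \<xi>) * hyp_poly n a q y"
    unfolding hyp_poly_contiguous_mixed[OF q] using q by (simp add: algebra_simps)
  finally show "(real n + (\<alpha> + 1/2)) * J (2 * n) + (real n + (\<beta> + 1/2)) * J (2 * n + 1)
      = (2 * real n + 1 + \<alpha> + \<beta>) * (1 - (1 - x) / (1 + c))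
        * hyp_poly n (real n + 1 + \<alpha> + \<beta>) (\<beta> + 1/2) y"
    unfolding a' q_def[symmetric] \<xi>_def[symmetric] .
qed

section \<open>The product of \<open>K_coeff\<close> and \<open>f_prefactor\<close>\<close>

lemma power_neg_mult_divide:
  "(-1) ^ n * (z\<^sup>2) ^ n * complex_of_real (L / 4) ^ n = (- (z\<^sup>2 * complex_of_real L / 4)) ^ n"
  unfolding power_mult_distrib[symmetric] by (rule arg_cong[where f = "\<lambda>x. x ^ n"]) simp

lemma K_coeff_f_prefactor_even:
  assumes "\<mu>1 > 0" "\<mu>2 > 0" "\<sigma> \<in> {1, -1}" "\<bar>lam\<bar> > \<bar>c\<bar>"
  shows "complex_of_real (K_coeff (2 * n) \<sigma> lam \<mu>2 \<mu>1 c) * f_prefactor \<mu>1 \<mu>2 z2 (2 * n)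
     = (- (z2\<^sup>2 * complex_of_real (lam\<^sup>2 - c\<^sup>2) / 4)) ^ n
       / complex_of_real (fact n * pochhammer (real n + 1 + \<mu>1 + \<mu>2) n)"
proof -
  have "complex_of_real (K_coeff (2 * n) \<sigma> lam \<mu>2 \<mu>1 c) * f_prefactor \<mu>1 \<mu>2 z2 (2 * n)
      = (-1) ^ n * z2 ^ (2 * n) * complex_of_real (K_coeff (2 * n) \<sigma> lam \<mu>2 \<mu>1 c / sqrt (mu_fact \<mu>2 (2 * n))
      * sqrt (pochhammer (1/2 + \<mu>1) n / pochhammer (real n + 1 + \<mu>1 + \<mu>2) n))"
    by (simp add: f_prefactor_def)
  also have "\<dots> = (-1) ^ n * z2 ^ (2 * n) * complex_of_real (((lam\<^sup>2 - c\<^sup>2) / 4) ^ n / (fact n * pochhammer (real n + 1 + \<mu>1 + \<mu>2) n))"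
    unfolding K_coeff_prefactor_even[OF assms] ..
  also have "\<dots> = (-1) ^ n * (z2\<^sup>2) ^ n * complex_of_real ((lam\<^sup>2 - c\<^sup>2) / 4) ^ n
      / complex_of_real (fact n * pochhammer (real n + 1 + \<mu>1 + \<mu>2) n)"
    by (simp only: of_real_divide of_real_power times_divide_eq_right power_mult)
  finally show ?thesis
    unfolding power_neg_mult_divide .
qed

text \<open>Written as the coefficient at \<open>2 * n\<close> times a factor linear in
  \<open>z2\<close>, so that neighbouring terms can be added.\<close>

lemma K_coeff_f_prefactor_odd:
  assumes "\<mu>1 > 0" "\<mu>2 > 0" "\<sigma> \<in> {1, -1}" "\<bar>lam\<bar> > \<bar>c\<bar>"
  shows "complex_of_real (K_coeff (2 * n + 1) \<sigma> lam \<mu>2 \<mu>1 c) * f_prefactor \<mu>1 \<mu>2 z2 (2 * n + 1)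
     = - ((- (z2\<^sup>2 * complex_of_real (lam\<^sup>2 - c\<^sup>2) / 4)) ^ n
       / complex_of_real (fact n * pochhammer (real n + 1 + \<mu>1 + \<mu>2) n))
       * (z2 * complex_of_real ((lam - c * \<sigma>) / (2 * (2 * real n + 1 + \<mu>1 + \<mu>2))))"
proof -
  have poch: "pochhammer (real n + 1 + \<mu>1 + \<mu>2) (Suc n)
      = pochhammer (real n + 1 + \<mu>1 + \<mu>2) n * (2 * real n + 1 + \<mu>1 + \<mu>2)"
    unfolding pochhammer_Suc by simp
  have frac: "a * b / 2 / (d * (e * m)) = a / (d * e) * (b / (2 * m))" for a b d e m :: real
    by simp
  have cast: "(-1) ^ Suc n * z2 ^ (2 * n + 1) * complex_of_real (a ^ n / b * d)
      = - ((-1) ^ n * (z2\<^sup>2) ^ n * complex_of_real a ^ n / complex_of_real b) * (z2 * complex_of_real d)"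
    for a b d
    by (simp add: power_mult)
  have "complex_of_real (K_coeff (2 * n + 1) \<sigma> lam \<mu>2 \<mu>1 c) * f_prefactor \<mu>1 \<mu>2 z2 (2 * n + 1)
      = (-1) ^ Suc n * z2 ^ (2 * n + 1) * complex_of_real (K_coeff (2 * n + 1) \<sigma> lam \<mu>2 \<mu>1 c / sqrt (mu_fact \<mu>2 (2 * n + 1))
      * sqrt (pochhammer (1/2 + \<mu>1) (Suc n) / pochhammer (real n + 1 + \<mu>1 + \<mu>2) (Suc n)))"
    by (simp add: f_prefactor_def)
  also have "\<dots> = (-1) ^ Suc n * z2 ^ (2 * n + 1) * complex_of_real (((lam\<^sup>2 - c\<^sup>2) / 4) ^ n * (lam - c * \<sigma>) / 2
        / (fact n * pochhammer (real n + 1 + \<mu>1 + \<mu>2) (Suc n)))"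
    unfolding K_coeff_prefactor_odd[OF assms] ..
  also have "((lam\<^sup>2 - c\<^sup>2) / 4) ^ n * (lam - c * \<sigma>) / 2 / (fact n * pochhammer (real n + 1 + \<mu>1 + \<mu>2) (Suc n))
      = ((lam\<^sup>2 - c\<^sup>2) / 4) ^ n / (fact n * pochhammer (real n + 1 + \<mu>1 + \<mu>2) n)
        * ((lam - c * \<sigma>) / (2 * (2 * real n + 1 + \<mu>1 + \<mu>2)))"
    unfolding poch by (rule frac)
  also have "(-1) ^ Suc n * z2 ^ (2 * n + 1) * complex_of_real (((lam\<^sup>2 - c\<^sup>2) / 4) ^ n / (fact n * pochhammer (real n + 1 + \<mu>1 + \<mu>2) n)
        * ((lam - c * \<sigma>) / (2 * (2 * real n + 1 + \<mu>1 + \<mu>2))))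
      = - ((-1) ^ n * (z2\<^sup>2) ^ n * complex_of_real ((lam\<^sup>2 - c\<^sup>2) / 4) ^ n
      / complex_of_real (fact n * pochhammer (real n + 1 + \<mu>1 + \<mu>2) n))
        * (z2 * complex_of_real ((lam - c * \<sigma>) / (2 * (2 * real n + 1 + \<mu>1 + \<mu>2))))"
    by (rule cast)
  finally show ?thesis
    unfolding power_neg_mult_divide .
qed

lemma sums_even_odd:
  fixes f :: "nat \<Rightarrow> 'a::real_normed_vector"
  assumes "(\<lambda>n. f (2 * n)) sums a" "(\<lambda>n. f (2 * n + 1)) sums b"
  shows "f sums (a + b)"
proof -
  have "(\<Sum>i<n. f i) = (\<Sum>i<Suc n div 2. f (2 * i)) + (\<Sum>i<n div 2. f (2 * i + 1))" for n
  proof (induction n)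
    case (Suc n)
    then show ?case
      by (cases "even n") (auto elim!: evenE oddE)
  qed simp
  moreover have "filterlim (\<lambda>n. Suc n div 2) sequentially sequentially"
    by (rule filterlim_compose[OF filterlim_at_top_div_const_nat filterlim_Suc]) simp
  then have "(\<lambda>n. \<Sum>i<Suc n div 2. f (2 * i)) \<longlonglongrightarrow> a"
    by (rule filterlim_compose[OF assms(1)[unfolded sums_def]])
  moreover have "filterlim (\<lambda>n. n div 2) sequentially sequentially"
    by (rule filterlim_at_top_div_const_nat) simp
  then have "(\<lambda>n. \<Sum>i<n div 2. f (2 * i + 1)) \<longlonglongrightarrow> b"
    by (rule filterlim_compose[OF assms(2)[unfolded sums_def]])
  ultimately show ?thesis
    unfolding sums_def by (simp add: tendsto_add)
qed

section \<open>The factors \<open>f_even\<close> and \<open>f_odd\<close> for each parity\<close>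

lemma f_even_even:
  "f_even \<mu>1 \<mu>2 \<epsilon> z1 z2 (2 * n) = f_prefactor \<mu>1 \<mu>2 z2 (2 * n)
     * (hyp_poly n (1 - real n - (\<mu>2 + 1/2)) (\<mu>1 + 1/2) (- (z1 / z2)\<^sup>2)
        + complex_of_real (real n) * (z1 / (z2 * complex_of_real (\<epsilon> * (\<mu>1 + 1/2))))
          * hyp_poly (n - 1) (1 - real n - (\<mu>2 + 1/2)) (\<mu>1 + 1/2 + 1) (- (z1 / z2)\<^sup>2))"
proof -
  have 1: "1/2 - real n - 0 - \<mu>2 = 1 - real n - (\<mu>2 + 1/2)" "1/2 - real n - \<mu>2 = 1 - real n - (\<mu>2 + 1/2)"
    "1/2 + \<mu>1 = \<mu>1 + 1/2" "3/2 + \<mu>1 = \<mu>1 + 1/2 + 1" "\<epsilon> * (1 + 2 * \<mu>1) = 2 * (\<epsilon> * (\<mu>1 + 1/2))"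
    by (simp_all add: algebra_simps)
  have 2: "hyp2F1 (1 - real n - 0) a b z = hyp_poly (n - 1) a b z" if "n > 0" for a b and z :: complex
    using hyp2F1_neg_nat[of "n - 1" a b z] that by (simp add: of_nat_diff)
  have 3: "2 * n div 2 = n" "2 * n mod 2 = 0"
    by simp_all
  show ?thesis
    unfolding f_even_def Let_def 3 of_nat_0 1 hyp2F1_neg_nat
    by (cases "n = 0") (simp_all add: 2[simplified])
qed

lemma f_even_odd:
  "f_even \<mu>1 \<mu>2 \<epsilon> z1 z2 (2 * n + 1) = f_prefactor \<mu>1 \<mu>2 z2 (2 * n + 1)
     * (hyp_poly n (- real n - (\<mu>2 + 1/2)) (\<mu>1 + 1/2) (- (z1 / z2)\<^sup>2)
        - complex_of_real (real n + (\<mu>2 + 1/2)) * (z1 / (z2 * complex_of_real (\<epsilon> * (\<mu>1 + 1/2))))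
          * hyp_poly n (1 - real n - (\<mu>2 + 1/2)) (\<mu>1 + 1/2 + 1) (- (z1 / z2)\<^sup>2))"
proof -
  have 1: "1/2 - real n - 1 - \<mu>2 = - real n - (\<mu>2 + 1/2)" "1/2 - real n - \<mu>2 = 1 - real n - (\<mu>2 + 1/2)"
    "1/2 + \<mu>1 = \<mu>1 + 1/2" "3/2 + \<mu>1 = \<mu>1 + 1/2 + 1" "\<epsilon> * (1 + 2 * \<mu>1) = 2 * (\<epsilon> * (\<mu>1 + 1/2))"
    "1 - real n - 1 = - real n" "real (2 * n + 1) + 2 * \<mu>2 * 1 = 2 * (real n + (\<mu>2 + 1/2))"
    by (simp_all add: algebra_simps)
  have 3: "(2 * n + 1) div 2 = n" "(2 * n + 1) mod 2 = 1"
    by simp_all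
  have 4: "(-1) ^ 1 * z1 * complex_of_real (2 * a) / (z2 * complex_of_real (2 * b))
      = - (complex_of_real a * (z1 / (z2 * complex_of_real b)))" for a b
    by simp
  show ?thesis
    unfolding f_even_def Let_def 3 of_nat_1 1 hyp2F1_neg_nat 4 by simp
qed

text \<open>In the expansion \<open>f_odd\<close> is multiplied by the root \<open>z2 * s\<close>.
  Its \<open>s\<close> cancels the inverse in \<open>f_odd\<close>, so the result is independent of
  the choice of the root.\<close>

lemma f_odd_even:
  assumes "s \<noteq> 0"
  shows "f_odd \<mu>1 \<mu>2 \<epsilon> z1 z2 s (2 * n) * s = f_prefactor \<mu>1 \<mu>2 z2 (2 * n)
     * (hyp_poly n (- real n - (\<mu>2 + 1/2)) (\<mu>1 + 1/2) (- (z1 / z2)\<^sup>2)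
        + complex_of_real (real n + (\<mu>1 + 1/2)) * (z1 / (z2 * complex_of_real (\<epsilon> * (\<mu>1 + 1/2))))
          * hyp_poly n (1 - real n - (\<mu>2 + 1/2)) (\<mu>1 + 1/2 + 1) (- (z1 / z2)\<^sup>2))"
proof -
  have 1: "- 1/2 - real n - \<mu>2 = - real n - (\<mu>2 + 1/2)" "1/2 - real n - 0 - \<mu>2 = 1 - real n - (\<mu>2 + 1/2)"
    "1/2 + \<mu>1 = \<mu>1 + 1/2" "3/2 + \<mu>1 = \<mu>1 + 1/2 + 1" "\<epsilon> * (1 + 2 * \<mu>1) = 2 * (\<epsilon> * (\<mu>1 + 1/2))"
    "- real n - 0 = - real n" "real (2 * n) + 1 + 2 * \<mu>1 + 2 * \<mu>2 * 0 = 2 * (real n + (\<mu>1 + 1/2))"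
    by (simp_all add: algebra_simps)
  have 3: "2 * n div 2 = n" "2 * n mod 2 = 0"
    by simp_all
  have 4: "(-1) ^ 0 * z1 * complex_of_real (2 * a) / (z2 * complex_of_real (2 * b))
      = complex_of_real a * (z1 / (z2 * complex_of_real b))" for a b
    by simp
  show ?thesis
    unfolding f_odd_def Let_def 3 of_nat_0 1 hyp2F1_neg_nat 4 using assms by simp
qed

lemma f_odd_odd:
  assumes "s \<noteq> 0"
  shows "f_odd \<mu>1 \<mu>2 \<epsilon> z1 z2 s (2 * n + 1) * s = f_prefactor \<mu>1 \<mu>2 z2 (2 * n + 1)
     * (hyp_poly (Suc n) (- real n - (\<mu>2 + 1/2)) (\<mu>1 + 1/2) (- (z1 / z2)\<^sup>2)
        - complex_of_real (real n + 1 + \<mu>1 + \<mu>2) * (z1 / (z2 * complex_of_real (\<epsilon> * (\<mu>1 + 1/2))))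
          * hyp_poly n (- real n - (\<mu>2 + 1/2)) (\<mu>1 + 1/2 + 1) (- (z1 / z2)\<^sup>2))"
proof -
  have 1: "- 1/2 - real n - \<mu>2 = - real n - (\<mu>2 + 1/2)" "1/2 - real n - 1 - \<mu>2 = - real n - (\<mu>2 + 1/2)"
    "1/2 + \<mu>1 = \<mu>1 + 1/2" "3/2 + \<mu>1 = \<mu>1 + 1/2 + 1" "\<epsilon> * (1 + 2 * \<mu>1) = 2 * (\<epsilon> * (\<mu>1 + 1/2))"
    "- real n - 1 = - real (Suc n)" "real (2 * n + 1) + 1 + 2 * \<mu>1 + 2 * \<mu>2 * 1 = 2 * (real n + 1 + \<mu>1 + \<mu>2)"
    by (simp_all add: algebra_simps)
  have 3: "(2 * n + 1) div 2 = n" "(2 * n + 1) mod 2 = 1"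
    by simp_all
  have 4: "(-1) ^ 1 * z1 * complex_of_real (2 * a) / (z2 * complex_of_real (2 * b))
      = - (complex_of_real a * (z1 / (z2 * complex_of_real b)))" for a b
    by simp
  show ?thesis
    unfolding f_odd_def Let_def 3 of_nat_1 1 hyp2F1_neg_nat 4 using assms by simp
qed

section \<open>Matching of arguments and collection of neighbouring terms\<close>

text \<open>\<open>L\<close> is a product of two linear factors, and up to \<open>lam2\<close> one
  of them is \<open>1 + c'\<close>. Thus \<open>L * y\<close> and \<open>L * (1 - y)\<close> give
  the arguments of the two 0F1, while the identities with \<xi> give the coefficients of the shifted
  0F1.\<close>

lemma jacobi_argument_identities:
  fixes \<epsilon>1 \<epsilon>2 c lam1 lam2 :: real
  assumes "\<epsilon>1 \<in> {1, -1}" "\<epsilon>2 \<in> {1, -1}" "\<bar>lam2\<bar> > \<bar>lam1\<bar>" "\<bar>lam1\<bar> > \<bar>c\<bar>"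
  defines "x \<equiv> \<epsilon>2 * lam1 / lam2" and "c' \<equiv> - (c * \<epsilon>1 * \<epsilon>2 / lam2)" and "L \<equiv> lam2\<^sup>2 - c\<^sup>2"
  defines "y \<equiv> (1 - x\<^sup>2) / (1 - c'\<^sup>2)" and "\<xi> \<equiv> (1 - x) / (1 + c')"
  shows "L > 0" "L * y = lam2\<^sup>2 - lam1\<^sup>2" "L * (1 - y) = lam1\<^sup>2 - c\<^sup>2"
    "L * (\<xi> - y) = - (\<epsilon>2 * (lam2 - lam1 * \<epsilon>2) * (lam1 - c * \<epsilon>1))"
    "(lam2 - c * (\<epsilon>1 * \<epsilon>2)) * \<xi> = lam2 - lam1 * \<epsilon>2"
    "(lam2 - c * (\<epsilon>1 * \<epsilon>2)) * (1 - \<xi>) = \<epsilon>2 * (lam1 - c * \<epsilon>1)"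
proof -
  have sq: "\<epsilon>1\<^sup>2 = 1" "\<epsilon>2\<^sup>2 = 1"
    using assms(1,2) by auto
  show L: "L > 0"
    using abs_le_square_iff[of lam2 c] assms(3,4) unfolding L_def by linarith
  have lam2: "lam2 \<noteq> 0"
    using assms(3) by auto
  have fac: "lam2\<^sup>2 - c\<^sup>2 = (lam2 - c * (\<epsilon>1 * \<epsilon>2)) * (lam2 + c * (\<epsilon>1 * \<epsilon>2))"
    using assms(1,2) by (auto simp: algebra_simps power2_eq_square)
  then have ne: "lam2 - c * (\<epsilon>1 * \<epsilon>2) \<noteq> 0"
    using L unfolding L_def by auto
  have "1 - x\<^sup>2 = (lam2\<^sup>2 - lam1\<^sup>2) / lam2\<^sup>2" "1 - c'\<^sup>2 = L / lam2\<^sup>2"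
    using lam2 sq by (simp_all add: x_def c'_def L_def power_divide power_mult_distrib diff_divide_distrib)
  then have y: "y = (lam2\<^sup>2 - lam1\<^sup>2) / L"
    using lam2 by (simp add: y_def)
  have "1 - x = (lam2 - lam1 * \<epsilon>2) / lam2" "1 + c' = (lam2 - c * (\<epsilon>1 * \<epsilon>2)) / lam2"
    using lam2 by (simp_all add: x_def c'_def diff_divide_distrib mult.commute mult.assoc)
  then have \<xi>: "\<xi> = (lam2 - lam1 * \<epsilon>2) / (lam2 - c * (\<epsilon>1 * \<epsilon>2))"
    using lam2 by (simp add: \<xi>_def)
  show Ly: "L * y = lam2\<^sup>2 - lam1\<^sup>2"
    using L by (simp add: y)
  then show "L * (1 - y) = lam1\<^sup>2 - c\<^sup>2"
    by (simp add: right_diff_distrib L_def)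
  show \<xi>1: "(lam2 - c * (\<epsilon>1 * \<epsilon>2)) * \<xi> = lam2 - lam1 * \<epsilon>2"
    using ne by (simp add: \<xi>)
  then show "(lam2 - c * (\<epsilon>1 * \<epsilon>2)) * (1 - \<xi>) = \<epsilon>2 * (lam1 - c * \<epsilon>1)"
    by (simp add: right_diff_distrib algebra_simps)
  have "L * \<xi> = (lam2 + c * (\<epsilon>1 * \<epsilon>2)) * ((lam2 - c * (\<epsilon>1 * \<epsilon>2)) * \<xi>)"
    unfolding L_def fac by simp
  then have "L * (\<xi> - y) = (lam2 + c * (\<epsilon>1 * \<epsilon>2)) * (lam2 - lam1 * \<epsilon>2) - (lam2\<^sup>2 - lam1\<^sup>2)"
    unfolding \<xi>1 right_diff_distrib Ly by simp
  also have "\<dots> = - (\<epsilon>2 * (lam2 - lam1 * \<epsilon>2) * (lam1 - c * \<epsilon>1))"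
    using assms(1,2) by (auto simp: algebra_simps power2_eq_square)
  finally show "L * (\<xi> - y) = - (\<epsilon>2 * (lam2 - lam1 * \<epsilon>2) * (lam1 - c * \<epsilon>1))" .
qed

text \<open>The quotient of neighbouring coefficients turns out to be \<open>b / a\<close>; with it,
  \<open>j0\<close> and \<open>j1\<close> appear in precisely the combinations of
  \<open>big_m1_jacobi_even_odd_pred\<close>.\<close>

lemma sum_pair_regroup:
  fixes P Q \<kappa> :: "'a::real_normed_field"
  assumes "a \<noteq> 0"
  shows "of_real j0 * (P + of_real b * \<kappa> * Q) + of_real (b / a * j1) * (P - of_real a * \<kappa> * Q)
       = P * of_real ((a * j0 + b * j1) / a) + \<kappa> * Q * of_real (b * (j0 - j1))"
proof -
  have "of_real (b / a * j1) * of_real a = (of_real (b * j1) :: 'a)"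
    unfolding of_real_mult[symmetric] using assms by simp
  moreover have "of_real ((a * j0 + b * j1) / a) = (of_real j0 + of_real (b / a * j1) :: 'a)"
    unfolding of_real_add[symmetric] using assms by (simp add: field_simps)
  ultimately show ?thesis
    by (simp add: algebra_simps del: of_real_divide)
qed

section \<open>Assembly from four Bateman expansions\<close>

theorem proposition5p2:
  fixes \<mu>1 \<mu>2 \<epsilon>1 \<epsilon>2 c lam1 lam2 :: real and z1 z2 s :: complex
  assumes "\<mu>1 > 0" and "\<mu>2 > 0"
    and "\<epsilon>1 \<in> {1, -1}" and "\<epsilon>2 \<in> {1, -1}"
    and "\<bar>lam2\<bar> > \<bar>lam1\<bar>" and "\<bar>lam1\<bar> > \<bar>c\<bar>"
    and "z2 \<noteq> 0"
    and "s\<^sup>2 = z1\<^sup>2 / z2\<^sup>2 + 1" and "s \<noteq> 0"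
  shows
    "(\<lambda>j. let \<mu>12 = \<mu>1 + \<mu>2 + 1/2 + real j; \<epsilon>12 = \<epsilon>1 * \<epsilon>2 * (-1) ^ j in
        complex_of_real (K_coeff j (\<epsilon>1 * \<epsilon>2) lam2 \<mu>2 \<mu>1 c)
        * complex_of_real
            (big_m1_jacobi j (\<epsilon>2 * lam1 / lam2) (2 * \<mu>2) (2 * \<mu>1) (- (c * \<epsilon>1 * \<epsilon>2 / lam2)))
        * (f_even \<mu>1 \<mu>2 \<epsilon>2 z1 z2 j
             * hyp0F1 (\<mu>12 + 1/2) ((z1\<^sup>2 + z2\<^sup>2) * complex_of_real (lam2\<^sup>2 - c\<^sup>2) / 4)
           + f_odd \<mu>1 \<mu>2 \<epsilon>2 z1 z2 s j
             * ((z2 * s) * complex_of_real (lam2 - c * \<epsilon>12) / complex_of_real (2 * \<mu>12 + 1))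
             * hyp0F1 (\<mu>12 + 3/2) ((z1\<^sup>2 + z2\<^sup>2) * complex_of_real (lam2\<^sup>2 - c\<^sup>2) / 4)))
     sums
     ((hyp0F1 (\<mu>1 + 1/2) (z1\<^sup>2 * complex_of_real (lam1\<^sup>2 - c\<^sup>2) / 4)
       + z1 * complex_of_real (lam1 - c * \<epsilon>1) / complex_of_real (2 * \<mu>1 + 1)
         * hyp0F1 (\<mu>1 + 3/2) (z1\<^sup>2 * complex_of_real (lam1\<^sup>2 - c\<^sup>2) / 4))
      * (hyp0F1 (\<mu>2 + 1/2) (z2\<^sup>2 * complex_of_real (lam2\<^sup>2 - lam1\<^sup>2) / 4)
         + z2 * complex_of_real (lam2 - lam1 * \<epsilon>2) / complex_of_real (2 * \<mu>2 + 1)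
           * hyp0F1 (\<mu>2 + 3/2) (z2\<^sup>2 * complex_of_real (lam2\<^sup>2 - lam1\<^sup>2) / 4)))"
proof -
  define M where "M = \<mu>1 + \<mu>2"
  define p where "p = \<mu>1 + 1/2"
  define q where "q = \<mu>2 + 1/2"
  define \<sigma> where "\<sigma> = \<epsilon>1 * \<epsilon>2"
  define L where "L = lam2\<^sup>2 - c\<^sup>2"
  define x where "x = \<epsilon>2 * lam1 / lam2"
  define c' where "c' = - (c * \<epsilon>1 * \<epsilon>2 / lam2)"
  define y where "y = (1 - x\<^sup>2) / (1 - c'\<^sup>2)"
  define \<xi> where "\<xi> = (1 - x) / (1 + c')"
  define U where "U = z1\<^sup>2 * complex_of_real L / 4"
  define V where "V = z2\<^sup>2 * complex_of_real L / 4"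
  define W where "W = - (z1 / z2)\<^sup>2"
  define \<kappa> where "\<kappa> = z1 / (z2 * complex_of_real (\<epsilon>2 * p))"
  define J where "J = (\<lambda>n. big_m1_jacobi n x (2 * \<mu>2) (2 * \<mu>1) c')"
  \<comment> \<open>\<open>e n\<close> is the coefficient of term \<open>2n\<close> and
    \<open>- e n * \<theta> n\<close> that of term \<open>2n + 1\<close>. The same
    \<open>\<theta> n\<close> is also the factor next to \<open>f_odd * s\<close> at index
    \<open>2n\<close>, and \<open>\<eta> n\<close> the one at \<open>2n + 1\<close>; this
    coincidence gives \<open>B n\<close> and \<open>A' n\<close> a common factor.\<close>
  define e where "e = (\<lambda>n. (- V) ^ n / complex_of_real (fact n * pochhammer (real n + 1 + M) n))"
  define \<theta> where "\<theta> = (\<lambda>n. z2 * complex_of_real ((lam2 - c * \<sigma>) / (2 * (2 * real n + 1 + M))))"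
  define \<eta> where "\<eta> = (\<lambda>n. z2 * complex_of_real ((lam2 + c * \<sigma>) / (2 * (2 * real n + 2 + M))))"
  define P where "P = (\<lambda>n. hyp_poly n (1 - real n - q) p W)"
  define Q where "Q = (\<lambda>n. hyp_poly (n - 1) (1 - real n - q) (p + 1) W)"
  define P' where "P' = (\<lambda>n. hyp_poly n (- real n - q) p W)"
  define Q' where "Q' = (\<lambda>n. hyp_poly n (1 - real n - q) (p + 1) W)"
  define X where "X = (\<lambda>j. hyp0F1 (M + 1 + real j) (U + V))"
  \<comment> \<open>\<open>A\<close>, \<open>B\<close> are the summands with \<open>f_even\<close>,
    \<open>f_odd\<close> at even index, \<open>A'\<close>, \<open>B'\<close> those at odd
    index.\<close>
  define A where "A = (\<lambda>n. e n * complex_of_real (J (2 * n)) * (P n + complex_of_real (real n) * \<kappa> * Q n) * X (2 * n))"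
  define B where "B = (\<lambda>n. e n * \<theta> n * complex_of_real (J (2 * n)) * (P' n + complex_of_real (real n + p) * \<kappa> * Q' n) * X (2 * n + 1))"
  define A' where "A' = (\<lambda>n. - (e n * \<theta> n * complex_of_real (J (2 * n + 1)) * (P' n - complex_of_real (real n + q) * \<kappa> * Q' n) * X (2 * n + 1)))"
  define B' where "B' = (\<lambda>n. - (e n * \<theta> n * \<eta> n * complex_of_real (J (2 * n + 1)) * (P (Suc n) - complex_of_real (real n + 1 + M) * \<kappa> * Q (Suc n)) * X (2 * n + 2)))"
  \<comment> \<open>The bound \<open>p\<close>, \<open>q\<close> shadow the fixed ones, since all
    four shifts of the parameters are needed.\<close>
  define Bat where "Bat = (\<lambda>p q n. (- V) ^ n / complex_of_real (fact n * pochhammer (real n + p + q - 1) n)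
          * hyp_poly n (1 - real n - q) p W * complex_of_real (hyp_poly n (real n + p + q - 1) q y)
          * hyp0F1 (p + q + 2 * real n) (U + V))"
  define T where "T = (\<lambda>j. let \<mu>12 = \<mu>1 + \<mu>2 + 1/2 + real j; \<epsilon>12 = \<epsilon>1 * \<epsilon>2 * (-1) ^ j in
        complex_of_real (K_coeff j (\<epsilon>1 * \<epsilon>2) lam2 \<mu>2 \<mu>1 c)
        * complex_of_real
            (big_m1_jacobi j (\<epsilon>2 * lam1 / lam2) (2 * \<mu>2) (2 * \<mu>1) (- (c * \<epsilon>1 * \<epsilon>2 / lam2)))
        * (f_even \<mu>1 \<mu>2 \<epsilon>2 z1 z2 j
             * hyp0F1 (\<mu>12 + 1/2) ((z1\<^sup>2 + z2\<^sup>2) * complex_of_real (lam2\<^sup>2 - c\<^sup>2) / 4)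
           + f_odd \<mu>1 \<mu>2 \<epsilon>2 z1 z2 s j
             * ((z2 * s) * complex_of_real (lam2 - c * \<epsilon>12) / complex_of_real (2 * \<mu>12 + 1))
             * hyp0F1 (\<mu>12 + 3/2) ((z1\<^sup>2 + z2\<^sup>2) * complex_of_real (lam2\<^sup>2 - c\<^sup>2) / 4)))"
  have pos: "M > 0" "p > 0" "q > 0" and M: "M = p + q - 1"
    using assms(1,2) by (auto simp: M_def p_def q_def)
  have \<epsilon>2: "\<epsilon>2 * \<epsilon>2 = 1" "\<epsilon>2 \<noteq> 0"
    using assms(4) by auto
  have \<sigma>: "\<sigma> \<in> {1, -1}" "\<sigma> * \<sigma> = 1"
    using assms(3,4) by (auto simp: \<sigma>_def)
  have lam2: "\<bar>lam2\<bar> > \<bar>c\<bar>"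
    using assms(5,6) by simp
  note arg = jacobi_argument_identities[OF assms(3-6), folded x_def c'_def L_def, folded y_def \<xi>_def, folded \<sigma>_def]
  have V: "V \<noteq> 0"
    using assms(7) arg(1) by (simp add: V_def)
  have UVW: "- (U / V) = W"
    using assms(7) arg(1) by (simp add: U_def V_def W_def power_divide)
  have S: "(z1\<^sup>2 + z2\<^sup>2) * complex_of_real L / 4 = U + V"
    by (simp add: U_def V_def algebra_simps add_divide_distrib)
  have bat: "Bat p q sums (hyp0F1 p (U * complex_of_real (1 - y)) * hyp0F1 q (V * complex_of_real y))"
    if "p > 0" "q > 0" for p q
    using bateman_expansion[OF that V, where U = U and y = y] unfolding Bat_def UVW .

  have T_even: "T (2 * n) = A n + B n" for n
  proof -
    have K: "complex_of_real (K_coeff (2 * n) \<sigma> lam2 \<mu>2 \<mu>1 c) * f_prefactor \<mu>1 \<mu>2 z2 (2 * n) = e n"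
      using K_coeff_f_prefactor_even[OF assms(1,2) \<sigma>(1) lam2, of n z2]
      by (simp add: e_def V_def L_def M_def add.assoc)
    have fe: "f_even \<mu>1 \<mu>2 \<epsilon>2 z1 z2 (2 * n) = f_prefactor \<mu>1 \<mu>2 z2 (2 * n) * (P n + complex_of_real (real n) * \<kappa> * Q n)"
      unfolding f_even_even P_def Q_def \<kappa>_def p_def q_def W_def ..
    have fo: "f_odd \<mu>1 \<mu>2 \<epsilon>2 z1 z2 s (2 * n) * s
        = f_prefactor \<mu>1 \<mu>2 z2 (2 * n) * (P' n + complex_of_real (real n + p) * \<kappa> * Q' n)"
      unfolding f_odd_even[OF assms(9)] P'_def Q'_def \<kappa>_def p_def q_def W_def ..
    have args: "\<mu>1 + \<mu>2 + 1/2 + real (2 * n) + 1/2 = M + 1 + real (2 * n)"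
      "\<mu>1 + \<mu>2 + 1/2 + real (2 * n) + 3/2 = M + 1 + real (2 * n + 1)"
      "2 * (\<mu>1 + \<mu>2 + 1/2 + real (2 * n)) + 1 = 2 * (2 * real n + 1 + M)"
      "lam2 - c * (\<sigma> * (-1) ^ (2 * n)) = lam2 - c * \<sigma>"
      by (simp_all add: M_def)
    have "T (2 * n) = complex_of_real (K_coeff (2 * n) \<sigma> lam2 \<mu>2 \<mu>1 c) * complex_of_real (J (2 * n))
        * (f_even \<mu>1 \<mu>2 \<epsilon>2 z1 z2 (2 * n) * X (2 * n) + f_odd \<mu>1 \<mu>2 \<epsilon>2 z1 z2 s (2 * n)
          * ((z2 * s) * complex_of_real (lam2 - c * \<sigma>) / complex_of_real (2 * (2 * real n + 1 + M))) * X (2 * n + 1))"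
      unfolding T_def Let_def \<sigma>_def[symmetric] args x_def[symmetric] c'_def[symmetric] L_def[symmetric] S X_def J_def ..
    also have "\<dots> = complex_of_real (K_coeff (2 * n) \<sigma> lam2 \<mu>2 \<mu>1 c) * complex_of_real (J (2 * n))
        * (f_even \<mu>1 \<mu>2 \<epsilon>2 z1 z2 (2 * n) * X (2 * n) + (f_odd \<mu>1 \<mu>2 \<epsilon>2 z1 z2 s (2 * n) * s) * \<theta> n * X (2 * n + 1))"
      unfolding \<theta>_def by simp
    also have "\<dots> = (complex_of_real (K_coeff (2 * n) \<sigma> lam2 \<mu>2 \<mu>1 c) * f_prefactor \<mu>1 \<mu>2 z2 (2 * n)) * complex_of_real (J (2 * n))
        * ((P n + complex_of_real (real n) * \<kappa> * Q n) * X (2 * n)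
           + (P' n + complex_of_real (real n + p) * \<kappa> * Q' n) * \<theta> n * X (2 * n + 1))"
      unfolding fe fo by (simp only: distrib_left mult.assoc mult.left_commute mult.commute)
    also have "\<dots> = A n + B n"
      unfolding K A_def B_def by (simp only: distrib_left mult.assoc mult.left_commute mult.commute)
    finally show ?thesis .
  qed

  have T_odd: "T (2 * n + 1) = A' n + B' n" for n
  proof -
    have K: "complex_of_real (K_coeff (2 * n + 1) \<sigma> lam2 \<mu>2 \<mu>1 c) * f_prefactor \<mu>1 \<mu>2 z2 (2 * n + 1) = - e n * \<theta> n"
      using K_coeff_f_prefactor_odd[OF assms(1,2) \<sigma>(1) lam2, of n z2]
      by (simp add: e_def \<theta>_def V_def L_def M_def add.assoc)
    have fe: "f_even \<mu>1 \<mu>2 \<epsilon>2 z1 z2 (2 * n + 1) = f_prefactor \<mu>1 \<mu>2 z2 (2 * n + 1) * (P' n - complex_of_real (real n + q) * \<kappa> * Q' n)"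
      unfolding f_even_odd P'_def Q'_def \<kappa>_def p_def q_def W_def ..
    have fo: "f_odd \<mu>1 \<mu>2 \<epsilon>2 z1 z2 s (2 * n + 1) * s
        = f_prefactor \<mu>1 \<mu>2 z2 (2 * n + 1) * (P (Suc n) - complex_of_real (real n + 1 + M) * \<kappa> * Q (Suc n))"
      unfolding f_odd_odd[OF assms(9)] P_def Q_def \<kappa>_def p_def q_def W_def M_def by (simp add: add.assoc)
    have args: "\<mu>1 + \<mu>2 + 1/2 + real (2 * n + 1) + 1/2 = M + 1 + real (2 * n + 1)"
      "\<mu>1 + \<mu>2 + 1/2 + real (2 * n + 1) + 3/2 = M + 1 + real (2 * n + 2)"
      "2 * (\<mu>1 + \<mu>2 + 1/2 + real (2 * n + 1)) + 1 = 2 * (2 * real n + 2 + M)"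
      "lam2 - c * (\<sigma> * (-1) ^ (2 * n + 1)) = lam2 + c * \<sigma>"
      by (simp_all add: M_def)
    have "T (2 * n + 1) = complex_of_real (K_coeff (2 * n + 1) \<sigma> lam2 \<mu>2 \<mu>1 c) * complex_of_real (J (2 * n + 1))
        * (f_even \<mu>1 \<mu>2 \<epsilon>2 z1 z2 (2 * n + 1) * X (2 * n + 1) + f_odd \<mu>1 \<mu>2 \<epsilon>2 z1 z2 s (2 * n + 1)
          * ((z2 * s) * complex_of_real (lam2 + c * \<sigma>) / complex_of_real (2 * (2 * real n + 2 + M))) * X (2 * n + 2))"
      unfolding T_def Let_def \<sigma>_def[symmetric] args x_def[symmetric] c'_def[symmetric] L_def[symmetric] S X_def J_def ..
    also have "\<dots> = complex_of_real (K_coeff (2 * n + 1) \<sigma> lam2 \<mu>2 \<mu>1 c) * complex_of_real (J (2 * n + 1))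
        * (f_even \<mu>1 \<mu>2 \<epsilon>2 z1 z2 (2 * n + 1) * X (2 * n + 1) + (f_odd \<mu>1 \<mu>2 \<epsilon>2 z1 z2 s (2 * n + 1) * s) * \<eta> n * X (2 * n + 2))"
      unfolding \<eta>_def by simp
    also have "\<dots> = (complex_of_real (K_coeff (2 * n + 1) \<sigma> lam2 \<mu>2 \<mu>1 c) * f_prefactor \<mu>1 \<mu>2 z2 (2 * n + 1)) * complex_of_real (J (2 * n + 1))
        * ((P' n - complex_of_real (real n + q) * \<kappa> * Q' n) * X (2 * n + 1)
           + (P (Suc n) - complex_of_real (real n + 1 + M) * \<kappa> * Q (Suc n)) * \<eta> n * X (2 * n + 2))"
      unfolding fe fo by (simp only: distrib_left mult.assoc mult.left_commute mult.commute)
    also have "\<dots> = A' n + B' n"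
      unfolding K A'_def B'_def
      by (simp only: distrib_left mult.assoc mult.left_commute mult.commute mult_minus_left mult_minus_right)
    finally show ?thesis .
  qed

  have poch_pos: "pochhammer (real n + 1 + M) k > 0" "pochhammer (real n + 2 + M) k > 0" for n k
    using pos by (auto intro!: pochhammer_pos)
  \<comment> \<open>It arises here from the difference relation for the Jacobi polynomials;
    \<open>arg(4)\<close> later factors it into the coefficients of the two shifted 0F1.\<close>
  define \<rho> where "\<rho> = - V * \<kappa> * complex_of_real ((\<xi> - y) / q)"

  \<comment> \<open>All four quantities carry the 0F1 with parameter
    \<open>M + 1 + (2n + 2)\<close>. The shift leaves \<open>A 0\<close> and
    \<open>Bat p q 0\<close> over; they are matched separately.\<close>
  have even_part: "A (Suc n) + B' n = Bat p q (Suc n) + \<rho> * Bat (p + 1) (q + 1) n" for n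
  proof -
    define a where "a = real n + 1 + M"
    define b where "b = real n + 1"
    define m where "m = 2 * real n + 2 + M"
    define F1 where "F1 = hyp_poly (Suc n) (real n + 1 + M) q y"
    define F2 where "F2 = hyp_poly n (real n + 2 + M) (q + 1) y"
    define ea where "ea = 1 / (fact (Suc n) * pochhammer (real n + 2 + M) (Suc n))"
    have am: "a > 0" "m > 0" "b > 0"
      using pos by (auto simp: a_def m_def b_def)
    have JJ: "a * J (2 * Suc n) + b * J (2 * n + 1) = m * F1"
      "J (2 * Suc n) - J (2 * n + 1) = m * (\<xi> - y) / q * F2"
      using big_m1_jacobi_even_odd_pred[OF assms(1,2), of n x c', folded y_def \<xi>_def]
      by (simp_all add: J_def F1_def F2_def a_def b_def m_def M_def q_def add.assoc)
    have p1: "pochhammer (real n + 1 + M) (Suc n) * m = a * pochhammer (real n + 2 + M) (Suc n)"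
      using pochhammer_rec[of "real n + 1 + M" "Suc n"] pochhammer_rec'[of "real n + 1 + M" "Suc n"]
      by (simp add: a_def m_def algebra_simps)
    have p2: "pochhammer (real n + 2 + M) (Suc n) = pochhammer (real n + 2 + M) n * m"
      unfolding pochhammer_Suc by (simp add: m_def algebra_simps)
    have p3: "pochhammer (real n + 1 + M) (Suc n) = pochhammer (real n + 1 + M) n * (2 * real n + 1 + M)"
      unfolding pochhammer_Suc by (simp add: algebra_simps)
    have e1: "e (Suc n) = (- V) ^ Suc n * complex_of_real ea"
      by (simp add: e_def ea_def add.assoc add.left_commute add.commute)
    \<comment> \<open>Through this product \<open>\<theta> n * \<eta> n\<close> contributes one more
      factor \<open>V\<close>, which raises \<open>(- V) ^ n\<close> to the power occurring in
      \<open>e (Suc n)\<close>.\<close>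
    have "(lam2 - c * \<sigma>) * (lam2 + c * \<sigma>) = L"
      using \<sigma> by (auto simp: L_def algebra_simps power2_eq_square)
    moreover have "l / (2 * k) * (r / (2 * m)) = l * r / 4 * (1 / (k * m))" for l r k :: real
      by simp
    ultimately have "(lam2 - c * \<sigma>) / (2 * (2 * real n + 1 + M)) * ((lam2 + c * \<sigma>) / (2 * m))
        = L / 4 * (1 / ((2 * real n + 1 + M) * m))"
      by (simp only:)
    moreover have "(z2 * complex_of_real u) * (z2 * complex_of_real v) = z2\<^sup>2 * complex_of_real (u * v)"
      "z2\<^sup>2 * complex_of_real L / 4 * complex_of_real v = z2\<^sup>2 * complex_of_real (L / 4 * v)" for u v
      by (simp_all add: power2_eq_square)
    ultimately have "\<theta> n * \<eta> n = V * complex_of_real (1 / ((2 * real n + 1 + M) * m))"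
      unfolding \<theta>_def \<eta>_def V_def m_def[symmetric] by (simp only:)
    then have "e n * \<theta> n * \<eta> n = - ((- V) ^ Suc n * complex_of_real
        (1 / (fact n * pochhammer (real n + 1 + M) n) * (1 / ((2 * real n + 1 + M) * m))))"
      unfolding e_def mult.assoc by simp
    also have "1 / (fact n * pochhammer (real n + 1 + M) n) * (1 / ((2 * real n + 1 + M) * m))
        = 1 / (fact n * (a * pochhammer (real n + 2 + M) (Suc n)))"
      unfolding p1[symmetric] p3 by simp
    also have "\<dots> = ea * (b / a)"
      using am by (simp add: ea_def b_def add.commute)
    finally have e2: "e n * \<theta> n * \<eta> n = - ((- V) ^ Suc n * complex_of_real (ea * (b / a)))" .
    have X2: "X (2 * Suc n) = X (2 * n + 2)"
      by simp
    have "A (Suc n) + B' n = (- V) ^ Suc n * X (2 * n + 2) * complex_of_real ea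
        * (complex_of_real (J (2 * Suc n)) * (P (Suc n) + complex_of_real b * \<kappa> * Q (Suc n))
         + complex_of_real (b / a * J (2 * n + 1)) * (P (Suc n) - complex_of_real a * \<kappa> * Q (Suc n)))"
      unfolding A_def B'_def e1 e2 X2 of_real_mult a_def[symmetric]
      by (simp add: b_def algebra_simps)
    also have "\<dots> = (- V) ^ Suc n * X (2 * n + 2) * complex_of_real ea
        * (P (Suc n) * complex_of_real (m * F1 / a) + \<kappa> * Q (Suc n) * complex_of_real (b * (m * (\<xi> - y) / q * F2)))"
      using am by (subst sum_pair_regroup) (simp_all only: JJ)
    also have "\<dots> = (- V) ^ Suc n * complex_of_real (ea * m / a) * P (Suc n) * complex_of_real F1 * X (2 * n + 2)
        + - V * \<kappa> * complex_of_real ((\<xi> - y) / q)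
          * ((- V) ^ n * complex_of_real (ea * m * b) * Q (Suc n) * complex_of_real F2 * X (2 * n + 2))"
      by (simp add: algebra_simps)
    also have "ea * m / a = 1 / (fact (Suc n) * pochhammer (real n + 1 + M) (Suc n))"
    proof -
      have "ea * m / a = m / (fact (Suc n) * (a * pochhammer (real n + 2 + M) (Suc n)))"
      proof -
        have "1 / (f * g) * m / a = m / (f * (a * g))" for f g :: real
          by simp
        then show ?thesis
          unfolding ea_def .
      qed
      then show ?thesis
        unfolding p1[symmetric] using am by simp
    qed
    also have "ea * m * b = 1 / (fact n * pochhammer (real n + 2 + M) n)"
    proof -
      have "fact (Suc n) = b * fact n"
        by (simp add: b_def add.commute)
      then show ?thesis
        unfolding ea_def p2 using am by simp
    qed
    finally show ?thesis
      by (simp add: Bat_def \<rho>_def P_def Q_def X_def F1_def F2_def M algebra_simps)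
  qed

  \<comment> \<open>Here all quantities carry the parameter \<open>M + 1 + (2n + 1)\<close> and no
    index is shifted.\<close>
  have odd_part: "B n + A' n = z2 * complex_of_real ((lam2 - lam1 * \<epsilon>2) / (2 * q)) * Bat p (q + 1) n
      + z1 * complex_of_real ((lam1 - c * \<epsilon>1) / (2 * p)) * Bat (p + 1) q n" for n
  proof -
    define m where "m = 2 * real n + 1 + M"
    define F1 where "F1 = hyp_poly n (real n + 1 + M) (q + 1) y"
    define F2 where "F2 = hyp_poly n (real n + 1 + M) q y"
    define l where "l = lam2 - c * \<sigma>"
    have m: "m > 0"
      using pos by (auto simp: m_def)
    have JJ: "J (2 * n) - J (2 * n + 1) = m * \<xi> / q * F1"
      "(real n + p) * J (2 * n) + (real n + q) * J (2 * n + 1) = m * (1 - \<xi>) * F2"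
      using big_m1_jacobi_even_odd_succ[OF assms(1,2), of n x c', folded y_def \<xi>_def]
      by (simp_all add: J_def F1_def F2_def m_def M_def p_def q_def add.assoc)
    have "B n + A' n = e n * \<theta> n * X (2 * n + 1)
        * (P' n * complex_of_real (J (2 * n) - J (2 * n + 1))
          + \<kappa> * Q' n * complex_of_real ((real n + p) * J (2 * n) + (real n + q) * J (2 * n + 1)))"
      unfolding A'_def B_def by (simp add: algebra_simps)
    also have "\<dots> = e n * X (2 * n + 1) * (P' n * (\<theta> n * complex_of_real (m * \<xi> / q * F1))
          + Q' n * (\<theta> n * \<kappa> * complex_of_real (m * (1 - \<xi>) * F2)))"
      unfolding JJ by (simp only: distrib_left mult.assoc mult.left_commute mult.commute)
    also have "\<theta> n * complex_of_real (m * \<xi> / q * F1)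
        = z2 * complex_of_real (l / (2 * m) * (m * \<xi> / q * F1))"
      unfolding \<theta>_def m_def[symmetric] l_def[symmetric] of_real_mult by (simp only: mult.assoc)
    also have "l / (2 * m) * (m * \<xi> / q * F1) = (l * \<xi>) / (2 * q) * F1"
      using m by simp
    also have "l * \<xi> = lam2 - lam1 * \<epsilon>2"
      unfolding l_def by (rule arg(5))
    also have "\<theta> n * \<kappa> * complex_of_real (m * (1 - \<xi>) * F2)
        = (z2 * \<kappa>) * complex_of_real (l / (2 * m) * (m * (1 - \<xi>) * F2))"
      unfolding \<theta>_def m_def[symmetric] l_def[symmetric] of_real_mult
      by (simp only: mult.assoc mult.left_commute mult.commute)
    also have "l / (2 * m) * (m * (1 - \<xi>) * F2) = l * (1 - \<xi>) / 2 * F2"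
      using m by simp
    also have "l * (1 - \<xi>) = \<epsilon>2 * (lam1 - c * \<epsilon>1)"
      unfolding l_def by (rule arg(6))
    also have "z2 * \<kappa> * complex_of_real (\<epsilon>2 * (lam1 - c * \<epsilon>1) / 2 * F2)
        = z1 * complex_of_real ((lam1 - c * \<epsilon>1) / (2 * p) * F2)"
      using assms(7) \<epsilon>2 pos by (simp add: \<kappa>_def)
    finally have sum: "B n + A' n = e n * X (2 * n + 1)
        * (P' n * (z2 * complex_of_real ((lam2 - lam1 * \<epsilon>2) / (2 * q) * F1))
           + Q' n * (z1 * complex_of_real ((lam1 - c * \<epsilon>1) / (2 * p) * F2)))" .
    have args: "real n + p + (q + 1) - 1 = real n + 1 + M" "real n + (p + 1) + q - 1 = real n + 1 + M"
      "1 - real n - (q + 1) = - real n - q"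
      "p + (q + 1) + 2 * real n = M + 1 + real (2 * n + 1)" "(p + 1) + q + 2 * real n = M + 1 + real (2 * n + 1)"
      by (simp_all add: M)
    have "Bat p (q + 1) n = e n * P' n * complex_of_real F1 * X (2 * n + 1)"
      unfolding Bat_def args e_def P'_def F1_def X_def ..
    moreover have "Bat (p + 1) q n = e n * Q' n * complex_of_real F2 * X (2 * n + 1)"
      unfolding Bat_def args e_def Q'_def F2_def X_def ..
    ultimately show ?thesis
      unfolding sum of_real_mult by (simp only: distrib_left mult.assoc mult.left_commute mult.commute)
  qed

  \<comment> \<open>With base at least 1 this symbol dominates \<open>n!\<close>; the bound 1 is
    enough, as \<open>e\<close> contains another \<open>n!\<close> that yields convergence.\<close>
  have poch_ge_1: "norm (complex_of_real (pochhammer (real n + 1 + M) n)) \<ge> 1" for n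
  proof -
    have "1 \<le> (pochhammer 1 n :: real)"
      unfolding pochhammer_fact[symmetric] by (rule fact_ge_1)
    also have "\<dots> \<le> pochhammer (real n + 1 + M) n"
      using pos by (intro pochhammer_mono_base) auto
    finally show ?thesis
      by simp
  qed
  \<comment> \<open>The offset \<open>p + q + 2\<close> covers every parameter that occurs; fixing
    it avoids an undetermined bound in the applications.\<close>
  have gb_hyp: "geom_bounded (\<lambda>n. hyp_poly (m n) (a n) b z)"
    if "b > 0" "\<And>n. m n \<le> Suc n" "\<And>n. \<bar>a n\<bar> \<le> real n + (p + q + 2)" for m a b and z :: "'a::real_normed_field"
    using that by (rule geom_bounded_hyp_poly)
  have gb_J: "geom_bounded (\<lambda>n. complex_of_real (J (2 * n)))" "geom_bounded (\<lambda>n. complex_of_real (J (2 * n + 1)))"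
    unfolding J_def big_m1_jacobi_even big_m1_jacobi_odd divide_inverse[of _ "\<mu>2 + 1/2"] using assms(1,2)
    by (intro geom_bounded_intros gb_hyp; simp add: p_def q_def)+
  have gb_P: "geom_bounded P" "geom_bounded P'" "geom_bounded Q" "geom_bounded Q'"
      "geom_bounded (\<lambda>n. P (Suc n))" "geom_bounded (\<lambda>n. Q (Suc n))"
    unfolding P_def P'_def Q_def Q'_def using pos by (intro gb_hyp; simp add: abs_le_iff)+
  have gb_X: "geom_bounded (\<lambda>n. X (2 * n))" "geom_bounded (\<lambda>n. X (2 * n + 1))" "geom_bounded (\<lambda>n. X (2 * n + 2))"
    unfolding X_def using pos by (intro geom_bounded_intros; simp)+
  have gb_\<theta>: "geom_bounded \<theta>" "geom_bounded \<eta>"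
    unfolding \<theta>_def \<eta>_def using pos by (intro geom_bounded_intros; simp)+
  have gb_e: "geom_bounded (\<lambda>n. (- V) ^ n / complex_of_real (pochhammer (real n + 1 + M) n))"
    using poch_ge_1 by (intro geom_bounded_intros)
  have summable_e: "summable (\<lambda>n. e n * f n)" if "geom_bounded f" for f
  proof -
    have "summable (\<lambda>n. ((- V) ^ n / complex_of_real (pochhammer (real n + 1 + M) n) * f n) / fact n)"
      by (intro summable_geom_bounded_div_fact geom_bounded_mult gb_e that)
    then show ?thesis
      by (simp add: e_def ac_simps)
  qed
  have "summable A" "summable B" "summable A'" "summable B'"
    unfolding A_def B_def A'_def B'_def mult.assoc mult_minus_right[symmetric]
    by (intro summable_e geom_bounded_intros gb_J gb_P gb_X gb_\<theta>)+
  then have sums: "A sums suminf A" "B sums suminf B" "A' sums suminf A'" "B' sums suminf B'"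
    by (auto intro: summable_sums)

  define H where "H = (\<lambda>p q. hyp0F1 p (U * complex_of_real (1 - y)) * hyp0F1 q (V * complex_of_real y))"
  have sum1: "suminf A + suminf B' = H p q + \<rho> * H (p + 1) (q + 1)"
  proof -
    have "J (2 * 0) = 1"
      unfolding J_def big_m1_jacobi_even by (simp add: hyp_poly_def)
    then have "A 0 = Bat p q 0"
      by (simp add: A_def Bat_def e_def hyp_poly_def X_def M P_def)
    moreover have "(\<lambda>n. A (Suc n) + B' n) sums (suminf A - A 0 + suminf B')"
      using sums by (intro sums_add) (simp_all add: sums_Suc_iff)
    moreover have "(\<lambda>n. Bat p q (Suc n) + \<rho> * Bat (p + 1) (q + 1) n) sums (H p q - Bat p q 0 + \<rho> * H (p + 1) (q + 1))"
      using bat pos by (intro sums_add sums_mult) (simp_all add: sums_Suc_iff H_def)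
    ultimately show ?thesis
      using sums_unique2 unfolding even_part by fastforce
  qed
  have sum2: "suminf B + suminf A' = z2 * complex_of_real ((lam2 - lam1 * \<epsilon>2) / (2 * q)) * H p (q + 1)
      + z1 * complex_of_real ((lam1 - c * \<epsilon>1) / (2 * p)) * H (p + 1) q"
  proof -
    have "(\<lambda>n. B n + A' n) sums (suminf B + suminf A')"
      using sums by (intro sums_add)
    moreover have "(\<lambda>n. z2 * complex_of_real ((lam2 - lam1 * \<epsilon>2) / (2 * q)) * Bat p (q + 1) n
      + z1 * complex_of_real ((lam1 - c * \<epsilon>1) / (2 * p)) * Bat (p + 1) q n) sums
      (z2 * complex_of_real ((lam2 - lam1 * \<epsilon>2) / (2 * q)) * H p (q + 1)
      + z1 * complex_of_real ((lam1 - c * \<epsilon>1) / (2 * p)) * H (p + 1) q)"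
      using bat pos by (intro sums_add sums_mult) (simp_all add: H_def)
    ultimately show ?thesis
      unfolding odd_part by (rule sums_unique2)
  qed
  have T: "T sums ((suminf A + suminf B) + (suminf A' + suminf B'))"
    by (rule sums_even_odd) (simp_all only: T_even T_odd sums sums_add)
  \<comment> \<open>The factor \<open>L\<close> hidden in \<open>V\<close> makes
    \<open>arg(4)\<close> applicable, and the sign it contributes cancels the one in the denominator
    of \<open>\<kappa>\<close>.\<close>
  have \<rho>: "\<rho> = z1 * complex_of_real ((lam1 - c * \<epsilon>1) / (2 * p)) * (z2 * complex_of_real ((lam2 - lam1 * \<epsilon>2) / (2 * q)))"
  proof -
    have "\<rho> = - (z2\<^sup>2 * \<kappa> * complex_of_real (L * (\<xi> - y) / (4 * q)))"
      by (simp add: \<rho>_def V_def)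
    also have "\<dots> = z2\<^sup>2 * \<kappa> * complex_of_real (\<epsilon>2 * ((lam2 - lam1 * \<epsilon>2) * (lam1 - c * \<epsilon>1) / (4 * q)))"
      unfolding arg(4) by simp
    also have "z2\<^sup>2 * \<kappa> * complex_of_real (\<epsilon>2 * w) = z1 * z2 * complex_of_real (w / p)" for w
      using assms(7) \<epsilon>2 pos by (simp add: \<kappa>_def power2_eq_square)
    finally show ?thesis
      by (simp add: ac_simps)
  qed
  have regroup: "(a + b) + (a' + b') = (a + b') + (b + a')" for a b a' b' :: complex
    by simp
  have factor: "(a * b + g * h * (a' * b')) + (h * (a * b') + g * (a' * b)) = (a + g * a') * (b + h * b')"
    for a b a' b' g h :: complex
    by (simp add: algebra_simps)
  have total: "T sums ((hyp0F1 p (U * complex_of_real (1 - y))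
        + z1 * complex_of_real ((lam1 - c * \<epsilon>1) / (2 * p)) * hyp0F1 (p + 1) (U * complex_of_real (1 - y)))
      * (hyp0F1 q (V * complex_of_real y)
        + z2 * complex_of_real ((lam2 - lam1 * \<epsilon>2) / (2 * q)) * hyp0F1 (q + 1) (V * complex_of_real y)))"
    using T unfolding regroup[of "suminf A"] sum1 sum2 \<rho> H_def factor .
  have args: "U * complex_of_real (1 - y) = z1\<^sup>2 * complex_of_real (lam1\<^sup>2 - c\<^sup>2) / 4"
    "V * complex_of_real y = z2\<^sup>2 * complex_of_real (lam2\<^sup>2 - lam1\<^sup>2) / 4"
    unfolding U_def V_def arg(2,3)[symmetric] by simp_all
  have param_eqs: "p + 1 = \<mu>1 + 3/2" "q + 1 = \<mu>2 + 3/2" "2 * p = 2 * \<mu>1 + 1" "2 * q = 2 * \<mu>2 + 1"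
    by (simp_all add: p_def q_def)
  show ?thesis
    using total unfolding T_def args param_eqs of_real_divide times_divide_eq_right
    unfolding p_def q_def .
qed

end
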